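(* Let $G$ be a group with identity $e$ and let $(A,\Delta)$ be a regular $G$-cograded multiplier Hopf algebra with decomposition $A=\bigoplus_{p\in G}A_p$, where every $A_p$ is a finite-dimensional algebra with identity. Let $S$ be the antipode. For each $p\in G$ let $(e_{p,i})_i$ be a basis of $A_p$ and $(f_{p,i})_i$ the dual basis of $A_p'$. For $f\in A_e'$ define the linear functional $\varphi_f$ on $A$ by $\varphi_f(a)=\sum_{p,i}(f_{p,i}f)(a\,S^2(e_{p,i}))$. Then for every $p\in G$ and every $g\in A_p'$, $$g(a)=\sum_i\varphi_{f_{p^{-1},i}\,g}\big(a\,S(e_{p^{-1},i})\big)\qquad\text{for all }a\in A_p.$$ Consequently, $\varphi_h\neq0$ for some $h\in A_e'$.
   Context: All algebras are over $\mathbb{C}$ with non-degenerate product. $M(A)$ is the multiplier algebra of $A$; $\iota$ denotes identity maps. A multiplier Hopf algebra is a pair $(A,\Delta)$, where $\Delta:A\to M(A\otimes A)$ is a homomorphism such that $\Delta(a)(1\otimes b)\in A\otimes A$ and $(a\otimes 1)\Delta(b)\in A\otimes A$ for all $a,b\in A$, such that $(a\otimes1\otimes1)(\Delta\otimes\iota)(\Delta(b)(1\otimes c))=((\iota\otimes\Delta)((a\otimes1)\Delta(b)))(1\otimes1\otimes c)$ for all $a,b,c$, and such that the linear maps $a\otimes b\mapsto\Delta(a)(1\otimes b)$ and $a\otimes b\mapsto(a\otimes1)\Delta(b)$ are bijections of $A\otimes A$ onto itself. It has a unique counit $\varepsilon:A\to\mathbb{C}$ (a homomorphism with $(\varepsilon\otimes\iota)(\Delta(a)(1\otimes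 b))=ab$, $(\iota\otimes\varepsilon)((a\otimes1)\Delta(b))=ab$) and a unique antipode $S:A\to M(A)$ (an anti-homomorphism with $m((S\otimes\iota)(\Delta(a)(1\otimes b)))=\varepsilon(a)b$, $m((\iota\otimes S)((b\otimes1)\Delta(a)))=\varepsilon(a)b$, $m$ being multiplication). It is regular if $(A,\Delta^{\mathrm{op}})$ is also a multiplier Hopf algebra; equivalently $S$ is a bijection of $A$ onto $A$. $(A,\Delta)$ is $G$-cograded if there are non-trivial subalgebras $(A_p)_{p\in G}$ with $A=\bigoplus_{p\in G}A_p$, $A_pA_q=0$ for $p\ne q$, and $\Delta(A_{pq})(1\otimes A_q)=A_p\otimes A_q=(A_p\otimes1)\Delta(A_{pq})$ (linear spans) for all $p,q$. Then $M(A\otimes A)=\prod_{p,q}M(A_p\otimes A_q)$, and $\Delta_{p,q}:A_{pq}\to A_p\otimes A_q$ denotes the $(p,q)$-component of $\Delta$ restricted to $A_{pq}$. In the regular case $S(A_p)=A_{p^{-1}}$, so $S^2(A_p)=A_p$. For $f\in A_p'$ and $g\in A_q'$, the product $fg\in A_{pq}'$ is $(fg)(x)=(f\otimes g)(\Delta_{p,q}(x))$, $x\in A_{pq}$ (functionals on $A_p$ are extended by $0$ to the other components). In particular $f_{p^{-1},i}\,g\in A_e'$ for $g\in A_p'$. The sum defining $\varphi_f(a)$ is finite since $a$ has only finitely many non-zero components. *)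

theory Defs
  imports Complex_Main "HOL-Library.Poly_Mapping" "HOL-Algebra.Group"
begin

section \<open>Complex vector spaces and complex algebras\<close>

class complex_vector = ab_group_add +
  fixes scaleC :: "complex \<Rightarrow> 'a \<Rightarrow> 'a" (infixr "*\<^sub>C" 75)
  assumes scaleC_add_right: "c *\<^sub>C (x + y) = c *\<^sub>C x + c *\<^sub>C y"
    and scaleC_add_left: "(c + d) *\<^sub>C x = c *\<^sub>C x + d *\<^sub>C x"
    and scaleC_scaleC: "c *\<^sub>C (d *\<^sub>C x) = (c * d) *\<^sub>C x"
    and scaleC_one: "1 *\<^sub>C x = x"

interpretation cvec: vector_space "scaleC :: complex \<Rightarrow> 'a \<Rightarrow> 'a::complex_vector"
  by unfold_locales (simp_all add: scaleC_add_right scaleC_add_left scaleC_scaleC scaleC_one)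

text \<open>Algebras are associative and need not have an identity.\<close>

class complex_algebra = complex_vector + ring +
  assumes mult_scaleC_left: "(c *\<^sub>C x) * y = c *\<^sub>C (x * y)"
    and mult_scaleC_right: "x * (c *\<^sub>C y) = c *\<^sub>C (x * y)"

instantiation complex :: complex_algebra
begin
definition scaleC_complex :: "complex \<Rightarrow> complex \<Rightarrow> complex"
  where "scaleC_complex = (*)"
instance by standard (simp_all add: scaleC_complex_def algebra_simps)
end

abbreviation clinear :: "('a::complex_vector \<Rightarrow> 'b::complex_vector) \<Rightarrow> bool"
  where "clinear \<equiv> Vector_Spaces.linear scaleC scaleC"

lemma clinear_iff:
  "clinear f \<longleftrightarrow> (\<forall>x y. f (x + y) = f x + f y) \<and> (\<forall>c x. f (c *\<^sub>C x) = c *\<^sub>C f x)"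
  by (auto simp: Vector_Spaces.linear_iff cvec.vector_space_axioms)

lemma clinearI:
  "\<lbrakk>\<And>x y. f (x + y) = f x + f y; \<And>c x. f (c *\<^sub>C x) = c *\<^sub>C f x\<rbrakk> \<Longrightarrow> clinear f"
  by (simp add: clinear_iff)

lemma clinearD:
  assumes "clinear f"
  shows "f (x + y) = f x + f y" "f (c *\<^sub>C x) = c *\<^sub>C f x" "f 0 = 0"
    "f (- x) = - f x" "f (x - y) = f x - f y"
proof -
  interpret Vector_Spaces.linear scaleC scaleC f by (fact assms)
  show "f (x + y) = f x + f y" "f (c *\<^sub>C x) = c *\<^sub>C f x" "f 0 = 0"
    "f (- x) = - f x" "f (x - y) = f x - f y"
    by (simp_all add: add scale neg diff zero)
qed

definition cbilinear ::
  "('a::complex_vector \<Rightarrow> 'b::complex_vector \<Rightarrow> 'c::complex_vector) \<Rightarrow> bool"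
  where "cbilinear F \<longleftrightarrow> (\<forall>a. clinear (F a)) \<and> (\<forall>b. clinear (\<lambda>a. F a b))"

lemma cbilinearI:
  "\<lbrakk>\<And>a a' b. F (a + a') b = F a b + F a' b; \<And>a b b'. F a (b + b') = F a b + F a b';
    \<And>c a b. F (c *\<^sub>C a) b = c *\<^sub>C F a b; \<And>c a b. F a (c *\<^sub>C b) = c *\<^sub>C F a b\<rbrakk> \<Longrightarrow> cbilinear F"
  by (simp add: cbilinear_def clinear_iff)

definition nondegenerate :: "'a::complex_algebra set \<Rightarrow> bool"
  where "nondegenerate A \<longleftrightarrow>
    (\<forall>a\<in>A. (\<forall>b\<in>A. a * b = 0) \<longrightarrow> a = 0) \<and> (\<forall>a\<in>A. (\<forall>b\<in>A. b * a = 0) \<longrightarrow> a = 0)"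


section \<open>The algebraic tensor product\<close>

instantiation poly_mapping :: (type, complex_vector) complex_vector
begin
definition scaleC_poly_mapping :: "complex \<Rightarrow> ('a \<Rightarrow>\<^sub>0 'b) \<Rightarrow> ('a \<Rightarrow>\<^sub>0 'b)"
  where "scaleC_poly_mapping c = Poly_Mapping.map (scaleC c)"

lemma lookup_scaleC: "Poly_Mapping.lookup (c *\<^sub>C x) k = c *\<^sub>C Poly_Mapping.lookup x k"
  by (auto simp: scaleC_poly_mapping_def map.rep_eq when_def)

instance
  by standard (auto intro!: poly_mapping_eqI
      simp: lookup_scaleC lookup_add scaleC_add_right scaleC_add_left scaleC_scaleC scaleC_one)
end

text \<open>The free vector space on \<open>'a \<times> 'b\<close> modulo the span of the bilinearity relations.\<close>

definition tensor_relators ::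
  "(('a::complex_vector \<times> 'b::complex_vector) \<Rightarrow>\<^sub>0 complex) set"
  where "tensor_relators =
    {Poly_Mapping.single (a + a', b) 1 - Poly_Mapping.single (a, b) 1
       - Poly_Mapping.single (a', b) 1 | a a' b. True} \<union>
    {Poly_Mapping.single (a, b + b') 1 - Poly_Mapping.single (a, b) 1
       - Poly_Mapping.single (a, b') 1 | a b b'. True} \<union>
    {Poly_Mapping.single (c *\<^sub>C a, b) 1 - c *\<^sub>C Poly_Mapping.single (a, b) 1 | c a b. True} \<union>
    {Poly_Mapping.single (a, c *\<^sub>C b) 1 - c *\<^sub>C Poly_Mapping.single (a, b) 1 | c a b. True}"

definition tensor_rel ::
  "(('a::complex_vector \<times> 'b::complex_vector) \<Rightarrow>\<^sub>0 complex) \<Rightarrow> (('a \<times> 'b) \<Rightarrow>\<^sub>0 complex) \<Rightarrow> bool"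
  where "tensor_rel x y \<longleftrightarrow> x - y \<in> cvec.span tensor_relators"

lemma equivp_tensor_rel:
  "equivp (tensor_rel :: (('a::complex_vector \<times> 'b::complex_vector) \<Rightarrow>\<^sub>0 complex) \<Rightarrow> _)"
    (is "equivp ?R")
proof (rule equivpI)
  show "reflp ?R" by (simp add: reflp_def tensor_rel_def cvec.span_zero)
  show "symp ?R"
    by (metis cvec.span_neg minus_diff_eq sympI tensor_rel_def)
  show "transp ?R"
  proof (rule transpI)
    fix x y z :: "('a \<times> 'b) \<Rightarrow>\<^sub>0 complex"
    assume "tensor_rel x y" "tensor_rel y z"
    then have "(x - y) + (y - z) \<in> cvec.span tensor_relators"
      unfolding tensor_rel_def by (rule cvec.span_add)
    then show "tensor_rel x z" by (simp add: tensor_rel_def)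
  qed
qed

quotient_type (overloaded) ('a, 'b) tensor =
  "(('a::complex_vector \<times> 'b::complex_vector) \<Rightarrow>\<^sub>0 complex)" / tensor_rel
  by (rule equivp_tensor_rel)

instantiation tensor :: (complex_vector, complex_vector) complex_vector
begin

lift_definition zero_tensor :: "('a, 'b) tensor" is 0 .

lift_definition plus_tensor :: "('a, 'b) tensor \<Rightarrow> ('a, 'b) tensor \<Rightarrow> ('a, 'b) tensor" is "(+)"
proof -
  fix x y z w :: "('a \<times> 'b) \<Rightarrow>\<^sub>0 complex"
  assume "tensor_rel x y" "tensor_rel z w"
  then have "(x - y) + (z - w) \<in> cvec.span tensor_relators"
    unfolding tensor_rel_def by (rule cvec.span_add)
  then show "tensor_rel (x + z) (y + w)" by (simp add: tensor_rel_def algebra_simps)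
qed

lift_definition uminus_tensor :: "('a, 'b) tensor \<Rightarrow> ('a, 'b) tensor" is uminus
  unfolding tensor_rel_def by (metis cvec.span_neg minus_diff_minus)

lift_definition minus_tensor :: "('a, 'b) tensor \<Rightarrow> ('a, 'b) tensor \<Rightarrow> ('a, 'b) tensor" is "(-)"
proof -
  fix x y z w :: "('a \<times> 'b) \<Rightarrow>\<^sub>0 complex"
  assume "tensor_rel x y" "tensor_rel z w"
  then have "(x - y) - (z - w) \<in> cvec.span tensor_relators"
    unfolding tensor_rel_def by (rule cvec.span_diff)
  then show "tensor_rel (x - z) (y - w)" by (simp add: tensor_rel_def algebra_simps)
qed

lift_definition scaleC_tensor :: "complex \<Rightarrow> ('a, 'b) tensor \<Rightarrow> ('a, 'b) tensor" is scaleC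
  unfolding tensor_rel_def by (metis cvec.span_scale cvec.scale_right_diff_distrib)

instance
proof
  fix x y z :: "('a, 'b) tensor" and c d :: complex
  show "x + y + z = x + (y + z)" "x + y = y + x" "0 + x = x" "- x + x = 0" "x - y = x + - y"
    by (transfer, simp add: tensor_rel_def cvec.span_zero algebra_simps)+
  show "c *\<^sub>C (x + y) = c *\<^sub>C x + c *\<^sub>C y" "(c + d) *\<^sub>C x = c *\<^sub>C x + d *\<^sub>C x"
    "c *\<^sub>C (d *\<^sub>C x) = (c * d) *\<^sub>C x" "1 *\<^sub>C x = x"
    by (transfer, simp add: tensor_rel_def cvec.span_zero
        scaleC_add_right scaleC_add_left scaleC_scaleC scaleC_one)+
qed

end

lift_definition tens :: "'a::complex_vector \<Rightarrow> 'b::complex_vector \<Rightarrow> ('a, 'b) tensor"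
    (infixr "\<otimes>\<^sub>C" 72)
  is "\<lambda>a b. Poly_Mapping.single (a, b) 1" .

lemma cbilinear_tens: "cbilinear (\<otimes>\<^sub>C)"
proof (rule cbilinearI; transfer)
  fix a a' :: 'a and b :: 'b
  show "tensor_rel (Poly_Mapping.single (a + a', b) 1)
    (Poly_Mapping.single (a, b) 1 + Poly_Mapping.single (a', b) 1)"
    unfolding tensor_rel_def tensor_relators_def
    by (rule cvec.span_base) (unfold diff_diff_eq [symmetric], blast)
next
  fix a :: 'a and b b' :: 'b
  show "tensor_rel (Poly_Mapping.single (a, b + b') 1)
    (Poly_Mapping.single (a, b) 1 + Poly_Mapping.single (a, b') 1)"
    unfolding tensor_rel_def tensor_relators_def
    by (rule cvec.span_base) (unfold diff_diff_eq [symmetric], blast)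
next
  fix c and a :: 'a and b :: 'b
  show "tensor_rel (Poly_Mapping.single (c *\<^sub>C a, b) 1) (c *\<^sub>C Poly_Mapping.single (a, b) 1)"
    "tensor_rel (Poly_Mapping.single (a, c *\<^sub>C b) 1) (c *\<^sub>C Poly_Mapping.single (a, b) 1)"
    unfolding tensor_rel_def tensor_relators_def
    by (rule cvec.span_base; blast)+
qed

lemma tens_simps:
  fixes a a' :: "'a::complex_vector" and b b' :: "'b::complex_vector"
  shows
  "(a + a') \<otimes>\<^sub>C b = a \<otimes>\<^sub>C b + a' \<otimes>\<^sub>C b" "a \<otimes>\<^sub>C (b + b') = a \<otimes>\<^sub>C b + a \<otimes>\<^sub>C b'"
  "(c *\<^sub>C a) \<otimes>\<^sub>C b = c *\<^sub>C (a \<otimes>\<^sub>C b)" "a \<otimes>\<^sub>C (c *\<^sub>C b) = c *\<^sub>C (a \<otimes>\<^sub>C b)"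
  using cbilinear_tens [where 'a = 'a and 'b = 'b] by (auto simp: cbilinear_def clinear_iff)

lemma tensor_induct [case_names tens add, induct type: tensor]:
  assumes tens: "\<And>a b. P (a \<otimes>\<^sub>C b)" and add: "\<And>x y. \<lbrakk>P x; P y\<rbrakk> \<Longrightarrow> P (x + y)"
  shows "P (t :: ('a::complex_vector, 'b::complex_vector) tensor)"
proof -
  have "P (abs_tensor x)" for x :: "('a \<times> 'b) \<Rightarrow>\<^sub>0 complex"
  proof (induction x rule: update_induct)
    case const
    have "abs_tensor 0 = (0::'a) \<otimes>\<^sub>C (0::'b)"
      using tens_simps(3) [of 0 "0::'a" "0::'b"] by (simp add: zero_tensor.abs_eq [symmetric])
    then show ?case using tens by simp
  next
    case (update f k v)
    obtain a b where k: "k = (a, b)" by force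
    have "Poly_Mapping.single k v = v *\<^sub>C Poly_Mapping.single k (1::complex)"
      by (rule poly_mapping_eqI) (simp add: lookup_scaleC scaleC_complex_def lookup_single when_def)
    then have "abs_tensor (Poly_Mapping.single k v) = v *\<^sub>C (a \<otimes>\<^sub>C b)"
      by (simp add: k scaleC_tensor.abs_eq tens.abs_eq)
    also have "\<dots> = (v *\<^sub>C a) \<otimes>\<^sub>C b" by (simp add: tens_simps)
    finally have "P (abs_tensor (Poly_Mapping.single k v))" using tens by simp
    moreover have "Poly_Mapping.update k v f = f + Poly_Mapping.single k v"
      using update(1) by (intro poly_mapping_eqI)
        (auto simp: lookup_update lookup_add lookup_single when_def in_keys_iff)
    ultimately show ?case
      using add update by (simp add: plus_tensor.abs_eq [symmetric])
  qed
  from this [of "rep_tensor t"] show ?thesis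
    by (simp add: Quotient3_abs_rep [OF Quotient3_tensor])
qed

text \<open>
  The linear map \<open>A \<otimes> B \<rightarrow> V\<close> induced by a bilinear map \<open>A \<times> B \<rightarrow> V\<close>; the value for
  non-bilinear arguments is a dummy.
\<close>

definition free_extend ::
  "('a \<Rightarrow> 'b \<Rightarrow> 'v::complex_vector) \<Rightarrow> (('a \<times> 'b) \<Rightarrow>\<^sub>0 complex) \<Rightarrow> 'v"
  where "free_extend F x =
    (\<Sum>k\<in>Poly_Mapping.keys x. Poly_Mapping.lookup x k *\<^sub>C F (fst k) (snd k))"

lemma free_extend_superset:
  assumes "finite K" "Poly_Mapping.keys x \<subseteq> K"
  shows "free_extend F x = (\<Sum>k\<in>K. Poly_Mapping.lookup x k *\<^sub>C F (fst k) (snd k))"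
  unfolding free_extend_def
  by (rule sum.mono_neutral_left) (use assms in \<open>auto simp: in_keys_iff\<close>)

lemma clinear_free_extend: "clinear (free_extend F)"
proof (rule clinearI)
  fix x y :: "('a \<times> 'b) \<Rightarrow>\<^sub>0 complex" and c :: complex
  let ?K = "Poly_Mapping.keys x \<union> Poly_Mapping.keys y"
  have "Poly_Mapping.keys (x + y) \<subseteq> ?K" by (rule keys_add)
  then show "free_extend F (x + y) = free_extend F x + free_extend F y"
    by (simp add: free_extend_superset [of ?K] lookup_add scaleC_add_left sum.distrib)
  have "Poly_Mapping.keys (c *\<^sub>C x) \<subseteq> Poly_Mapping.keys x"
    by (auto simp: in_keys_iff lookup_scaleC)
  then show "free_extend F (c *\<^sub>C x) = c *\<^sub>C free_extend F x"
    by (simp add: free_extend_superset [of "Poly_Mapping.keys x"] lookup_scaleC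
        scaleC_complex_def scaleC_scaleC cvec.scale_sum_right)
qed

lemma free_extend_single: "free_extend F (Poly_Mapping.single (a, b) 1) = F a b"
  by (simp add: free_extend_def scaleC_one)

lemma free_extend_relators:
  assumes F: "cbilinear F" and x: "x \<in> cvec.span tensor_relators"
  shows "free_extend F x = 0"
  using x
proof (induction rule: cvec.span_induct_alt)
  case base
  show ?case by (simp add: clinearD(3) [OF clinear_free_extend])
next
  case (step c x y)
  have "free_extend F x = 0"
    using step(1) F
    by (auto simp: tensor_relators_def clinearD [OF clinear_free_extend] free_extend_single
        cbilinear_def clinear_iff)
  then show ?case
    using step by (simp add: clinearD [OF clinear_free_extend])
qed

lift_definition tensor_lift ::
  "('a::complex_vector \<Rightarrow> 'b::complex_vector \<Rightarrow> 'v::complex_vector) \<Rightarrow> ('a, 'b) tensor \<Rightarrow> 'v"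
  is "\<lambda>F x. if cbilinear F then free_extend F x else 0"
proof -
  fix F :: "'a \<Rightarrow> 'b \<Rightarrow> 'v" and x y :: "('a \<times> 'b) \<Rightarrow>\<^sub>0 complex"
  assume "tensor_rel x y"
  then have "cbilinear F \<Longrightarrow> free_extend F (x - y) = 0"
    by (simp add: tensor_rel_def free_extend_relators)
  then show "(if cbilinear F then free_extend F x else 0) =
      (if cbilinear F then free_extend F y else 0)"
    by (simp add: clinearD [OF clinear_free_extend])
qed

lemma clinear_tensor_lift: "clinear (tensor_lift F)"
  by (rule clinearI; transfer) (simp_all add: clinearD [OF clinear_free_extend])

lemma tensor_lift_tens [simp]: "cbilinear F \<Longrightarrow> tensor_lift F (a \<otimes>\<^sub>C b) = F a b"
  by transfer (simp add: free_extend_single)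

lemma tensor_lift_unique:
  assumes "clinear h" "\<And>a b. h (a \<otimes>\<^sub>C b) = F a b"
  shows "tensor_lift F = h"
proof -
  have "cbilinear F"
    unfolding assms(2) [symmetric]
    by (rule cbilinearI) (simp_all add: tens_simps clinearD [OF assms(1)])
  then show ?thesis
  proof (intro ext)
    fix t
    show "tensor_lift F t = h t"
      by (induction t) (simp_all add: \<open>cbilinear F\<close> assms clinearD [OF clinear_tensor_lift]
          clinearD [OF assms(1)])
  qed
qed

lemma cbilinear_clinear_comp: "\<lbrakk>clinear h; cbilinear F\<rbrakk> \<Longrightarrow> cbilinear (\<lambda>a b. h (F a b))"
  by (auto simp: cbilinear_def clinear_iff)

lemma cbilinear_tens_comp:
  "\<lbrakk>clinear f; clinear g\<rbrakk> \<Longrightarrow> cbilinear (\<lambda>a b. f a \<otimes>\<^sub>C g b)"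
  by (auto simp: cbilinear_def clinear_iff tens_simps)

definition tensor_map ::
  "('a::complex_vector \<Rightarrow> 'c::complex_vector) \<Rightarrow> ('b::complex_vector \<Rightarrow> 'd::complex_vector)
    \<Rightarrow> ('a, 'b) tensor \<Rightarrow> ('c, 'd) tensor"
  where "tensor_map f g = tensor_lift (\<lambda>a b. f a \<otimes>\<^sub>C g b)"

lemma clinear_tensor_map: "clinear (tensor_map f g)"
  by (simp add: tensor_map_def clinear_tensor_lift)

lemma tensor_map_tens:
  "\<lbrakk>clinear f; clinear g\<rbrakk> \<Longrightarrow> tensor_map f g (a \<otimes>\<^sub>C b) = f a \<otimes>\<^sub>C g b"
  by (simp add: tensor_map_def cbilinear_tens_comp)

definition tensor_functional ::
  "('a::complex_vector \<Rightarrow> complex) \<Rightarrow> ('b::complex_vector \<Rightarrow> complex) \<Rightarrow> ('a, 'b) tensor \<Rightarrow> complex"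
  where "tensor_functional f g = tensor_lift (\<lambda>a b. f a * g b)"

lemma tensor_functional_tens:
  "\<lbrakk>clinear f; clinear g\<rbrakk> \<Longrightarrow> tensor_functional f g (a \<otimes>\<^sub>C b) = f a * g b"
  unfolding tensor_functional_def
  by (rule tensor_lift_tens, rule cbilinearI)
    (simp_all add: clinearD algebra_simps scaleC_complex_def)

definition tensor_flip ::
  "('a::complex_vector, 'b::complex_vector) tensor \<Rightarrow> ('b, 'a) tensor"
  where "tensor_flip = tensor_lift (\<lambda>a b. b \<otimes>\<^sub>C a)"

lemma clinear_tensor_flip: "clinear tensor_flip"
  by (simp add: tensor_flip_def clinear_tensor_lift)

lemma tensor_flip_tens [simp]: "tensor_flip (a \<otimes>\<^sub>C b) = b \<otimes>\<^sub>C a"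
  unfolding tensor_flip_def
  by (rule tensor_lift_tens, rule cbilinearI) (simp_all add: tens_simps)

definition tensor_assoc ::
  "(('a::complex_vector, 'b::complex_vector) tensor, 'c::complex_vector) tensor
    \<Rightarrow> ('a, ('b, 'c) tensor) tensor"
  where "tensor_assoc = tensor_lift (\<lambda>t c. tensor_lift (\<lambda>a b. a \<otimes>\<^sub>C b \<otimes>\<^sub>C c) t)"

definition tensor_assoc_inv ::
  "('a::complex_vector, ('b::complex_vector, 'c::complex_vector) tensor) tensor
    \<Rightarrow> (('a, 'b) tensor, 'c) tensor"
  where "tensor_assoc_inv = tensor_lift (\<lambda>a t. tensor_lift (\<lambda>b c. (a \<otimes>\<^sub>C b) \<otimes>\<^sub>C c) t)"

lemma clinear_tensor_assoc: "clinear tensor_assoc" "clinear tensor_assoc_inv"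
  by (simp_all add: tensor_assoc_def tensor_assoc_inv_def clinear_tensor_lift)

lemma tensor_assoc_tens [simp]: "tensor_assoc ((a \<otimes>\<^sub>C b) \<otimes>\<^sub>C c) = a \<otimes>\<^sub>C b \<otimes>\<^sub>C c"
proof -
  have 1: "cbilinear (\<lambda>a b. a \<otimes>\<^sub>C b \<otimes>\<^sub>C c)" for c :: 'c
    by (rule cbilinearI) (simp_all add: tens_simps)
  have "cbilinear (\<lambda>t c. tensor_lift (\<lambda>(a::'a) (b::'b). a \<otimes>\<^sub>C b \<otimes>\<^sub>C (c::'c)) t)"
  proof (rule cbilinearI)
    fix t :: "('a, 'b) tensor" and c c' :: 'c and r
    show "tensor_lift (\<lambda>a b. a \<otimes>\<^sub>C b \<otimes>\<^sub>C (c + c')) t =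
        tensor_lift (\<lambda>a b. a \<otimes>\<^sub>C b \<otimes>\<^sub>C c) t + tensor_lift (\<lambda>a b. a \<otimes>\<^sub>C b \<otimes>\<^sub>C c') t"
      by (induction t) (simp_all only: tensor_lift_tens [OF 1],
        simp_all add: tens_simps scaleC_add_right clinearD [OF clinear_tensor_lift])
    show "tensor_lift (\<lambda>a b. a \<otimes>\<^sub>C b \<otimes>\<^sub>C (r *\<^sub>C c)) t = r *\<^sub>C tensor_lift (\<lambda>a b. a \<otimes>\<^sub>C b \<otimes>\<^sub>C c) t"
      by (induction t) (simp_all only: tensor_lift_tens [OF 1],
        simp_all add: tens_simps scaleC_add_right clinearD [OF clinear_tensor_lift])
  qed (simp_all add: clinearD [OF clinear_tensor_lift])
  then show ?thesis by (simp add: tensor_assoc_def 1)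
qed

lemma tensor_assoc_inv_tens [simp]: "tensor_assoc_inv (a \<otimes>\<^sub>C b \<otimes>\<^sub>C c) = (a \<otimes>\<^sub>C b) \<otimes>\<^sub>C c"
proof -
  have 1: "cbilinear (\<lambda>b c. (a \<otimes>\<^sub>C b) \<otimes>\<^sub>C c)" for a :: 'a
    by (rule cbilinearI) (simp_all add: tens_simps)
  have "cbilinear (\<lambda>a t. tensor_lift (\<lambda>(b::'b) (c::'c). ((a::'a) \<otimes>\<^sub>C b) \<otimes>\<^sub>C c) t)"
  proof (rule cbilinearI)
    fix t :: "('b, 'c) tensor" and a a' :: 'a and r
    show "tensor_lift (\<lambda>b c. ((a + a') \<otimes>\<^sub>C b) \<otimes>\<^sub>C c) t =
        tensor_lift (\<lambda>b c. (a \<otimes>\<^sub>C b) \<otimes>\<^sub>C c) t + tensor_lift (\<lambda>b c. (a' \<otimes>\<^sub>C b) \<otimes>\<^sub>C c) t"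
      by (induction t) (simp_all only: tensor_lift_tens [OF 1],
        simp_all add: tens_simps scaleC_add_right clinearD [OF clinear_tensor_lift])
    show "tensor_lift (\<lambda>b c. ((r *\<^sub>C a) \<otimes>\<^sub>C b) \<otimes>\<^sub>C c) t = r *\<^sub>C tensor_lift (\<lambda>b c. (a \<otimes>\<^sub>C b) \<otimes>\<^sub>C c) t"
      by (induction t) (simp_all only: tensor_lift_tens [OF 1],
        simp_all add: tens_simps scaleC_add_right clinearD [OF clinear_tensor_lift])
  qed (simp_all add: clinearD [OF clinear_tensor_lift])
  then show ?thesis by (simp add: tensor_assoc_inv_def 1)
qed

lemma tensor_assoc_inverse: "tensor_assoc_inv (tensor_assoc t) = t"
proof (induction t)
  case (tens s c)
  show ?case
    by (induction s) (simp_all add: tens_simps clinearD [OF clinear_tensor_assoc(1)]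
        clinearD [OF clinear_tensor_assoc(2)])
qed (simp_all add: clinearD [OF clinear_tensor_assoc(1)] clinearD [OF clinear_tensor_assoc(2)])

lemma tensor_assoc_inv_inverse: "tensor_assoc (tensor_assoc_inv t) = t"
proof (induction t)
  case (tens a s)
  show ?case
    by (induction s) (simp_all add: tens_simps clinearD [OF clinear_tensor_assoc(1)]
        clinearD [OF clinear_tensor_assoc(2)])
qed (simp_all add: clinearD [OF clinear_tensor_assoc(1)] clinearD [OF clinear_tensor_assoc(2)])

lemma clinear_mult_left: "clinear (\<lambda>x. a * x)" and clinear_mult_right: "clinear (\<lambda>x. x * a)"
  for a :: "'a::complex_algebra"
  by (simp_all add: clinear_iff algebra_simps mult_scaleC_left mult_scaleC_right)

instantiation tensor :: (complex_algebra, complex_algebra) complex_algebra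
begin

definition times_tensor :: "('a, 'b) tensor \<Rightarrow> ('a, 'b) tensor \<Rightarrow> ('a, 'b) tensor"
  where "times_tensor s t = tensor_lift (\<lambda>a b. tensor_map (\<lambda>x. a * x) (\<lambda>y. b * y) t) s"

lemma cbilinear_times_tensor_aux:
  "cbilinear (\<lambda>(a::'a) (b::'b). tensor_map (\<lambda>x. a * x) (\<lambda>y. b * y) t)"
proof (rule cbilinearI)
  fix a a' :: 'a and b b' :: 'b and c
  show "tensor_map (\<lambda>x. (a + a') * x) ((*) b) t =
      tensor_map (\<lambda>x. a * x) ((*) b) t + tensor_map (\<lambda>x. a' * x) ((*) b) t"
    by (induction t) (simp_all only: tensor_map_tens clinear_mult_left,
        simp_all add: tens_simps algebra_simps
        clinearD [OF clinear_tensor_map])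
  show "tensor_map ((*) a) (\<lambda>y. (b + b') * y) t =
      tensor_map ((*) a) (\<lambda>y. b * y) t + tensor_map ((*) a) (\<lambda>y. b' * y) t"
    by (induction t) (simp_all only: tensor_map_tens clinear_mult_left,
        simp_all add: tens_simps algebra_simps
        clinearD [OF clinear_tensor_map])
  show "tensor_map (\<lambda>x. (c *\<^sub>C a) * x) ((*) b) t = c *\<^sub>C tensor_map ((*) a) ((*) b) t"
    by (induction t) (simp_all only: tensor_map_tens clinear_mult_left,
        simp_all add: tens_simps
        mult_scaleC_left scaleC_add_right clinearD [OF clinear_tensor_map])
  show "tensor_map ((*) a) (\<lambda>y. (c *\<^sub>C b) * y) t = c *\<^sub>C tensor_map ((*) a) ((*) b) t"
    by (induction t) (simp_all only: tensor_map_tens clinear_mult_left,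
        simp_all add: tens_simps
        mult_scaleC_left scaleC_add_right clinearD [OF clinear_tensor_map])
qed

lemma tens_times_left:
  "(a \<otimes>\<^sub>C b) * (t :: ('a, 'b) tensor) = tensor_map (\<lambda>x. a * x) (\<lambda>y. b * y) t"
  unfolding times_tensor_def by (rule tensor_lift_tens) (rule cbilinear_times_tensor_aux)

lemma tens_times_tens:
  "(a \<otimes>\<^sub>C b) * (c \<otimes>\<^sub>C d :: ('a, 'b) tensor) = (a * c) \<otimes>\<^sub>C (b * d)"
  by (simp add: tens_times_left tensor_map_tens clinear_mult_left)

instance
proof
  fix r s t :: "('a, 'b) tensor" and c :: complex
  show distl: "(r + s) * t = r * t + s * t" for r s t :: "('a, 'b) tensor"
    by (simp add: times_tensor_def clinearD [OF clinear_tensor_lift])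
  show distr: "r * (s + t) = r * s + r * t" for r s t :: "('a, 'b) tensor"
    by (induction r) (simp_all add: distl tens_times_left clinearD [OF clinear_tensor_map])
  show "(c *\<^sub>C s) * t = c *\<^sub>C (s * t)"
    by (simp add: times_tensor_def clinearD [OF clinear_tensor_lift])
  show "s * (c *\<^sub>C t) = c *\<^sub>C (s * t)"
    by (induction s) (simp_all add: distl tens_times_left scaleC_add_right
        clinearD [OF clinear_tensor_map])
  show "r * s * t = r * (s * t)"
  proof (induction r)
    case (tens a b)
    show ?case
    proof (induction s)
      case (tens c d)
      show ?case by (induction t) (simp_all add: distr tens_times_tens mult.assoc)
    qed (simp_all add: distl distr)
  qed (simp_all add: distl)
qed

end


section \<open>The multiplier algebra\<close>

text \<open>
  A multiplier \<open>m\<close> is given by the pair of maps \<open>a \<mapsto> m a\<close> and \<open>a \<mapsto> a m\<close>.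
\<close>

definition is_multiplier :: "('a \<Rightarrow> 'a::complex_algebra) \<times> ('a \<Rightarrow> 'a) \<Rightarrow> bool"
  where "is_multiplier = (\<lambda>(L, R). clinear L \<and> clinear R \<and>
    (\<forall>a b. L (a * b) = L a * b) \<and> (\<forall>a b. R (a * b) = a * R b) \<and> (\<forall>a b. a * L b = R a * b))"

typedef (overloaded) 'a multiplier =
  "{m :: ('a::complex_algebra \<Rightarrow> 'a) \<times> ('a \<Rightarrow> 'a). is_multiplier m}"
  by (rule exI [of _ "(\<lambda>_. 0, \<lambda>_. 0)"]) (simp add: is_multiplier_def clinear_iff)

setup_lifting type_definition_multiplier

lift_definition lmul :: "'a::complex_algebra multiplier \<Rightarrow> 'a \<Rightarrow> 'a" is fst .
lift_definition rmul :: "'a::complex_algebra multiplier \<Rightarrow> 'a \<Rightarrow> 'a" is snd .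

lemma multiplier_eqI: "\<lbrakk>lmul m = lmul m'; rmul m = rmul m'\<rbrakk> \<Longrightarrow> m = m'"
  by transfer (auto simp: prod_eq_iff)

lemma multiplier_laws:
  "clinear (lmul m)" "clinear (rmul m)" "lmul m (a * b) = lmul m a * b"
  "rmul m (a * b) = a * rmul m b" "a * lmul m b = rmul m a * b"
  by (transfer, simp add: is_multiplier_def split_beta)+

instantiation multiplier :: (complex_algebra) "{complex_algebra, monoid_mult}"
begin

lift_definition zero_multiplier :: "'a multiplier" is "(\<lambda>_. 0, \<lambda>_. 0)"
  by (simp add: is_multiplier_def clinear_iff)

lift_definition one_multiplier :: "'a multiplier" is "(\<lambda>x. x, \<lambda>x. x)"
  by (simp add: is_multiplier_def clinear_iff)

lift_definition plus_multiplier :: "'a multiplier \<Rightarrow> 'a multiplier \<Rightarrow> 'a multiplier"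
  is "\<lambda>(L, R) (L', R'). (\<lambda>x. L x + L' x, \<lambda>x. R x + R' x)"
  by (auto simp: is_multiplier_def clinear_iff algebra_simps scaleC_add_right)

lift_definition uminus_multiplier :: "'a multiplier \<Rightarrow> 'a multiplier"
  is "\<lambda>(L, R). (\<lambda>x. - L x, \<lambda>x. - R x)"
  by (auto simp: is_multiplier_def clinear_iff algebra_simps)

lift_definition minus_multiplier :: "'a multiplier \<Rightarrow> 'a multiplier \<Rightarrow> 'a multiplier"
  is "\<lambda>(L, R) (L', R'). (\<lambda>x. L x - L' x, \<lambda>x. R x - R' x)"
  by (auto simp: is_multiplier_def clinear_iff algebra_simps cvec.scale_right_diff_distrib)

lift_definition scaleC_multiplier :: "complex \<Rightarrow> 'a multiplier \<Rightarrow> 'a multiplier"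
  is "\<lambda>c (L, R). (\<lambda>x. c *\<^sub>C L x, \<lambda>x. c *\<^sub>C R x)"
  by (auto simp: is_multiplier_def clinear_iff algebra_simps scaleC_add_right
      mult_scaleC_left mult_scaleC_right scaleC_scaleC)

lift_definition times_multiplier :: "'a multiplier \<Rightarrow> 'a multiplier \<Rightarrow> 'a multiplier"
  is "\<lambda>(L, R) (L', R'). (\<lambda>x. L (L' x), \<lambda>x. R' (R x))"
  by (auto simp: is_multiplier_def clinear_iff)

lemma lmul_simps:
  "lmul 0 = (\<lambda>_. 0)" "lmul 1 = (\<lambda>a. a)" "lmul (m + n) = (\<lambda>a. lmul m a + lmul n a)"
  "lmul (- m) = (\<lambda>a. - lmul m a)" "lmul (m - n) = (\<lambda>a. lmul m a - lmul n a)"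
  "lmul (c *\<^sub>C m) = (\<lambda>a. c *\<^sub>C lmul m a)" "lmul (m * n) = (\<lambda>a. lmul m (lmul n a))"
  by (transfer, simp add: split_beta)+

lemma rmul_simps:
  "rmul 0 = (\<lambda>_. 0)" "rmul 1 = (\<lambda>a. a)" "rmul (m + n) = (\<lambda>a. rmul m a + rmul n a)"
  "rmul (- m) = (\<lambda>a. - rmul m a)" "rmul (m - n) = (\<lambda>a. rmul m a - rmul n a)"
  "rmul (c *\<^sub>C m) = (\<lambda>a. c *\<^sub>C rmul m a)" "rmul (m * n) = (\<lambda>a. rmul n (rmul m a))"
  by (transfer, simp add: split_beta)+

instance
proof
  fix x y z :: "'a multiplier" and c d :: complex
  note [simp] = lmul_simps rmul_simps
  show "x + y + z = x + (y + z)" "x + y = y + x" "0 + x = x" "- x + x = 0" "x - y = x + - y"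
    by (rule multiplier_eqI; simp add: add.assoc; simp add: add.commute)+
  show "c *\<^sub>C (x + y) = c *\<^sub>C x + c *\<^sub>C y" "(c + d) *\<^sub>C x = c *\<^sub>C x + d *\<^sub>C x"
    "c *\<^sub>C (d *\<^sub>C x) = (c * d) *\<^sub>C x" "1 *\<^sub>C x = x"
    by (rule multiplier_eqI; simp add: scaleC_add_right scaleC_add_left scaleC_scaleC scaleC_one)+
  show "x * y * z = x * (y * z)" "1 * x = x" "x * 1 = x" "(x + y) * z = x * z + y * z"
    "x * (y + z) = x * y + x * z"
    "(c *\<^sub>C x) * y = c *\<^sub>C (x * y)" "x * (c *\<^sub>C y) = c *\<^sub>C (x * y)"
    by (rule multiplier_eqI;
        simp add: clinearD [OF multiplier_laws(1)] clinearD [OF multiplier_laws(2)])+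
qed

end

text \<open>The canonical map \<open>A \<rightarrow> M(A)\<close>, which is injective if the product is non-degenerate.\<close>

lift_definition incl :: "'a::complex_algebra \<Rightarrow> 'a multiplier" is "\<lambda>a. (\<lambda>x. a * x, \<lambda>x. x * a)"
  by (simp add: is_multiplier_def clinear_iff algebra_simps mult_scaleC_left mult_scaleC_right)

lemma lmul_incl: "lmul (incl a) = (\<lambda>x. a * x)" and rmul_incl: "rmul (incl a) = (\<lambda>x. x * a)"
  by (transfer, simp)+

lemma clinear_incl: "clinear incl"
  by (rule clinearI; transfer) (auto simp: algebra_simps mult_scaleC_left mult_scaleC_right)

lemma incl_mult: "incl (a * b) = incl a * incl b"
  by transfer (auto simp: mult.assoc)

lemma inj_incl: "nondegenerate (UNIV :: 'a::complex_algebra set) \<Longrightarrow> inj (incl :: 'a \<Rightarrow> _)"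
proof (rule injI)
  fix a b :: 'a
  assume nd: "nondegenerate (UNIV :: 'a set)" and "incl a = incl b"
  then have "\<forall>x. a * x = b * x" by transfer (auto dest: fun_cong)
  then have "\<forall>x. (a - b) * x = 0" by (simp add: left_diff_distrib)
  then have "a - b = 0" using nd unfolding nondegenerate_def by blast
  then show "a = b" by simp
qed

text \<open>The element of \<open>A\<close> represented by a multiplier that lies in \<open>A \<subseteq> M(A)\<close>.\<close>

definition the_elem_of :: "'a::complex_algebra multiplier \<Rightarrow> 'a"
  where "the_elem_of m = inv_into UNIV incl m"

text \<open>The canonical map \<open>M(A) \<times> M(B) \<rightarrow> M(A \<otimes> B)\<close>.\<close>

lift_definition mult_tens ::
  "'a::complex_algebra multiplier \<Rightarrow> 'b::complex_algebra multiplier \<Rightarrow> ('a, 'b) tensor multiplier"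
    (infixr "\<otimes>\<^sub>M" 72)
  is "\<lambda>(L, R) (L', R'). (tensor_map L L', tensor_map R R')"
proof (clarsimp simp: is_multiplier_def clinear_tensor_map, intro conjI allI)
  fix L R :: "'a \<Rightarrow> 'a" and L' R' :: "'b \<Rightarrow> 'b" and s t :: "('a, 'b) tensor"
  assume L: "clinear L" "clinear R" "clinear L'" "clinear R'"
    and m: "\<forall>a b. L (a * b) = L a * b" "\<forall>a b. L' (a * b) = L' a * b"
      "\<forall>a b. R (a * b) = a * R b" "\<forall>a b. R' (a * b) = a * R' b"
      "\<forall>a b. a * L b = R a * b" "\<forall>a b. a * L' b = R' a * b"
  note [simp] = L m tens_times_tens tensor_map_tens clinearD [OF clinear_tensor_map]
    distrib_left distrib_right
  show "tensor_map L L' (s * t) = tensor_map L L' s * t"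
  proof (induction s)
    case (tens a b)
    show ?case by (induction t) simp_all
  qed simp_all
  show "tensor_map R R' (s * t) = s * tensor_map R R' t"
  proof (induction s)
    case (tens a b)
    show ?case by (induction t) simp_all
  qed simp_all
  show "s * tensor_map L L' t = tensor_map R R' s * t"
  proof (induction s)
    case (tens a b)
    show ?case by (induction t) simp_all
  qed simp_all
qed

lemma lmul_mult_tens: "lmul (m \<otimes>\<^sub>M n) = tensor_map (lmul m) (lmul n)"
  by transfer auto

lemma rmul_mult_tens: "rmul (m \<otimes>\<^sub>M n) = tensor_map (rmul m) (rmul n)"
  by transfer auto

lemma mult_tens_incl: "incl a \<otimes>\<^sub>M incl b = incl (a \<otimes>\<^sub>C b)"
proof -
  have "tensor_map (\<lambda>x. a * x) (\<lambda>x. b * x) t = (a \<otimes>\<^sub>C b) * t" for t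
    by (simp add: tens_times_left)
  moreover have "tensor_map (\<lambda>x. x * a) (\<lambda>x. x * b) t = t * (a \<otimes>\<^sub>C b)" for t
    by (induction t) (simp_all add: tensor_map_tens tens_times_tens clinear_mult_right
        clinearD [OF clinear_tensor_map] distrib_right)
  ultimately show ?thesis
    by (intro multiplier_eqI) (simp_all add: lmul_mult_tens rmul_mult_tens lmul_incl rmul_incl fun_eq_iff)
qed

lemma cbilinear_mult_tens: "cbilinear (\<otimes>\<^sub>M)"
proof -
  note [simp] = multiplier_laws(1,2) clinearD [OF clinear_tensor_map] tensor_map_tens tens_simps
  have add: "tensor_map (\<lambda>x. f x + f' x) g t = tensor_map f g t + tensor_map f' g t"
      "tensor_map f (\<lambda>x. g x + g' x) t = tensor_map f g t + tensor_map f g' t"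
      "tensor_map (\<lambda>x. c *\<^sub>C f x) g t = c *\<^sub>C tensor_map f g t"
      "tensor_map f (\<lambda>x. c *\<^sub>C g x) t = c *\<^sub>C tensor_map f g t"
    if "clinear f" "clinear g" "clinear f'" "clinear g'"
    for f f' :: "'a \<Rightarrow> 'a" and g g' :: "'b \<Rightarrow> 'b" and c and t :: "('a, 'b) tensor"
  proof -
    have [simp]: "clinear (\<lambda>x. f x + f' x)" "clinear (\<lambda>x. g x + g' x)"
      "clinear (\<lambda>x. c *\<^sub>C f x)" "clinear (\<lambda>x. c *\<^sub>C g x)"
      using that by (simp_all add: clinear_iff scaleC_add_right scaleC_scaleC mult.commute)
    show "tensor_map (\<lambda>x. f x + f' x) g t = tensor_map f g t + tensor_map f' g t"
      "tensor_map f (\<lambda>x. g x + g' x) t = tensor_map f g t + tensor_map f g' t"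
      "tensor_map (\<lambda>x. c *\<^sub>C f x) g t = c *\<^sub>C tensor_map f g t"
      "tensor_map f (\<lambda>x. c *\<^sub>C g x) t = c *\<^sub>C tensor_map f g t"
      by (induction t; simp add: that scaleC_add_right)+
  qed
  show ?thesis
    by (rule cbilinearI; rule multiplier_eqI;
        simp add: lmul_mult_tens rmul_mult_tens lmul_simps rmul_simps fun_eq_iff
          add [OF multiplier_laws(1,1,1,1)] add [OF multiplier_laws(2,2,2,2)])
qed

text \<open>
  Transport of multipliers along an algebra isomorphism \<open>\<theta> : A \<rightarrow> B\<close>; the value for
  other maps is a dummy.
\<close>

definition algebra_iso :: "('a::complex_algebra \<Rightarrow> 'b::complex_algebra) \<Rightarrow> bool"
  where "algebra_iso \<theta> \<longleftrightarrow> clinear \<theta> \<and> (\<forall>x y. \<theta> (x * y) = \<theta> x * \<theta> y) \<and> bij \<theta>"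

lift_definition mult_transport ::
  "('a::complex_algebra \<Rightarrow> 'b::complex_algebra) \<Rightarrow> 'a multiplier \<Rightarrow> 'b multiplier"
  is "\<lambda>\<theta> (L, R). if algebra_iso \<theta>
    then (\<lambda>x. \<theta> (L (inv_into UNIV \<theta> x)), \<lambda>x. \<theta> (R (inv_into UNIV \<theta> x)))
    else (\<lambda>_. 0, \<lambda>_. 0)"
proof (clarsimp split: if_splits, intro conjI impI)
  fix \<theta> :: "'a \<Rightarrow> 'b" and L R :: "'a \<Rightarrow> 'a"
  assume m: "is_multiplier (L, R)" and iso: "algebra_iso \<theta>"
  have \<theta>: "\<theta> (x + y) = \<theta> x + \<theta> y" "\<theta> (c *\<^sub>C x) = c *\<^sub>C \<theta> x" "\<theta> (x * y) = \<theta> x * \<theta> y" for x y c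
    using iso by (auto simp: algebra_iso_def clinear_iff)
  have inv: "inv_into UNIV \<theta> (\<theta> x) = x" "\<theta> (inv_into UNIV \<theta> y) = y" for x y
    using iso by (auto simp: algebra_iso_def bij_is_inj bij_is_surj surj_f_inv_f)
  have inv_hom: "inv_into UNIV \<theta> (x + y) = inv_into UNIV \<theta> x + inv_into UNIV \<theta> y" 
    "inv_into UNIV \<theta> (c *\<^sub>C x) = c *\<^sub>C inv_into UNIV \<theta> x"
    "inv_into UNIV \<theta> (x * y) = inv_into UNIV \<theta> x * inv_into UNIV \<theta> y" for x y c
    using \<theta>(1) [of "inv_into UNIV \<theta> x" "inv_into UNIV \<theta> y"]
      \<theta>(2) [of c "inv_into UNIV \<theta> x"]
      \<theta>(3) [of "inv_into UNIV \<theta> x" "inv_into UNIV \<theta> y"] inv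
    by metis+
  show "is_multiplier (\<lambda>x. \<theta> (L (inv_into UNIV \<theta> x)), \<lambda>x. \<theta> (R (inv_into UNIV \<theta> x)))"
    unfolding is_multiplier_def prod.case
  proof (intro conjI allI)
    show "clinear (\<lambda>x. \<theta> (L (inv_into UNIV \<theta> x)))" "clinear (\<lambda>x. \<theta> (R (inv_into UNIV \<theta> x)))"
      using m by (simp_all add: is_multiplier_def clinear_iff inv_hom \<theta>(1,2))
    fix a b
    obtain x y where ab: "a = \<theta> x" "b = \<theta> y" using inv(2) by metis
    show "\<theta> (L (inv_into UNIV \<theta> (a * b))) = \<theta> (L (inv_into UNIV \<theta> a)) * b"
      "\<theta> (R (inv_into UNIV \<theta> (a * b))) = a * \<theta> (R (inv_into UNIV \<theta> b))"
      "a * \<theta> (L (inv_into UNIV \<theta> b)) = \<theta> (R (inv_into UNIV \<theta> a)) * b"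
      using m unfolding ab by (simp_all add: is_multiplier_def inv(1) \<theta>(3) [symmetric])
  qed
qed (simp add: is_multiplier_def clinear_iff)

lemma algebra_iso_tensor_flip:
  "algebra_iso (tensor_flip :: ('a::complex_algebra, 'b::complex_algebra) tensor \<Rightarrow> _)"
proof -
  have 1: "tensor_flip (tensor_flip t) = t" for t :: "('c::complex_algebra, 'd::complex_algebra) tensor"
    by (induction t) (simp_all add: clinearD [OF clinear_tensor_flip])
  have 2: "tensor_flip (s * t) = tensor_flip s * tensor_flip t" for s t :: "('a, 'b) tensor"
  proof (induction s)
    case (tens a b)
    show ?case
      by (induction t) (simp_all add: tens_times_tens distrib_left clinearD [OF clinear_tensor_flip])
  qed (simp_all add: distrib_right clinearD [OF clinear_tensor_flip])
  show ?thesis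
    unfolding algebra_iso_def by (auto simp: clinear_tensor_flip 2 intro!: o_bij 1)
qed

lemma algebra_iso_tensor_assoc:
  "algebra_iso (tensor_assoc ::
    (('a::complex_algebra, 'b::complex_algebra) tensor, 'c::complex_algebra) tensor \<Rightarrow> _)"
proof -
  note [simp] = tens_times_tens distrib_left distrib_right clinearD [OF clinear_tensor_assoc(1)]
    tens_simps
  have "tensor_assoc (s * t) = tensor_assoc s * tensor_assoc t"
    for s t :: "(('a, 'b) tensor, 'c) tensor"
  proof (induction s)
    case (tens u c)
    show ?case
    proof (induction t)
      case (tens v d)
      show ?case
      proof (induction u)
        case (tens a b)
        show ?case by (induction v) simp_all
      qed simp_all
    qed simp_all
  qed simp_all
  then show ?thesis
    unfolding algebra_iso_def
    by (auto simp: clinear_tensor_assoc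
        intro!: o_bij [of tensor_assoc_inv] tensor_assoc_inverse tensor_assoc_inv_inverse)
qed


section \<open>Multiplier Hopf algebras\<close>

definition algebra_hom :: "('a::complex_algebra \<Rightarrow> 'b::complex_algebra) \<Rightarrow> bool"
  where "algebra_hom h \<longleftrightarrow> clinear h \<and> (\<forall>a b. h (a * b) = h a * h b)"

definition algebra_antihom :: "('a::complex_algebra \<Rightarrow> 'b::complex_algebra) \<Rightarrow> bool"
  where "algebra_antihom h \<longleftrightarrow> clinear h \<and> (\<forall>a b. h (a * b) = h b * h a)"

type_synonym 'a coproduct = "'a \<Rightarrow> ('a, 'a) tensor multiplier"

text \<open>\<open>T1 \<Delta> a b = \<Delta>(a)(1 \<otimes> b)\<close> and \<open>T2 \<Delta> a b = (a \<otimes> 1)\<Delta>(b)\<close>, as elements of \<open>M(A \<otimes> A)\<close>.\<close>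

definition T1 :: "'a::complex_algebra coproduct \<Rightarrow> 'a \<Rightarrow> 'a \<Rightarrow> ('a, 'a) tensor multiplier"
  where "T1 \<Delta> a b = \<Delta> a * (1 \<otimes>\<^sub>M incl b)"

definition T2 :: "'a::complex_algebra coproduct \<Rightarrow> 'a \<Rightarrow> 'a \<Rightarrow> ('a, 'a) tensor multiplier"
  where "T2 \<Delta> a b = (incl a \<otimes>\<^sub>M 1) * \<Delta> b"

lemma cbilinear_T1: "clinear \<Delta> \<Longrightarrow> cbilinear (T1 \<Delta>)"
  and cbilinear_T2: "clinear \<Delta> \<Longrightarrow> cbilinear (T2 \<Delta>)"
  using cbilinear_mult_tens [where 'a = 'a and 'b = 'a] clinear_incl [where 'a = 'a]
  by (auto simp: T1_def T2_def cbilinear_def clinear_iff algebra_simps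
      mult_scaleC_left mult_scaleC_right)

text \<open>
  In \<open>coassociative\<close>, the left-hand side lives in \<open>M((A \<otimes> A) \<otimes> A)\<close> and the right-hand side in
  \<open>M(A \<otimes> (A \<otimes> A))\<close>; the two are identified along \<^term>\<open>tensor_assoc\<close>.
\<close>

definition coassociative :: "'a::complex_algebra coproduct \<Rightarrow> bool"
  where "coassociative \<Delta> \<longleftrightarrow> (\<forall>a b c.
    mult_transport tensor_assoc
      (((incl a \<otimes>\<^sub>M 1) \<otimes>\<^sub>M 1) * tensor_lift (\<lambda>x y. \<Delta> x \<otimes>\<^sub>M incl y) (the_elem_of (T1 \<Delta> b c))) =
    tensor_lift (\<lambda>x y. incl x \<otimes>\<^sub>M \<Delta> y) (the_elem_of (T2 \<Delta> a b)) * (1 \<otimes>\<^sub>M 1 \<otimes>\<^sub>M incl c))"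

definition multiplier_hopf_algebra :: "'a::complex_algebra coproduct \<Rightarrow> bool"
  where "multiplier_hopf_algebra \<Delta> \<longleftrightarrow>
    nondegenerate (UNIV :: 'a set) \<and>
    algebra_hom \<Delta> \<and>
    (\<forall>a b. T1 \<Delta> a b \<in> range incl) \<and> (\<forall>a b. T2 \<Delta> a b \<in> range incl) \<and>
    coassociative \<Delta> \<and>
    bij_betw (tensor_lift (T1 \<Delta>)) UNIV (range incl) \<and>
    bij_betw (tensor_lift (T2 \<Delta>)) UNIV (range incl)"

definition coproduct_op :: "'a::complex_algebra coproduct \<Rightarrow> 'a coproduct"
  where "coproduct_op \<Delta> a = mult_transport tensor_flip (\<Delta> a)"

definition regular_multiplier_hopf_algebra :: "'a::complex_algebra coproduct \<Rightarrow> bool"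
  where "regular_multiplier_hopf_algebra \<Delta> \<longleftrightarrow>
    multiplier_hopf_algebra \<Delta> \<and> multiplier_hopf_algebra (coproduct_op \<Delta>)"

definition is_counit :: "'a::complex_algebra coproduct \<Rightarrow> ('a \<Rightarrow> complex) \<Rightarrow> bool"
  where "is_counit \<Delta> \<epsilon> \<longleftrightarrow> algebra_hom \<epsilon> \<and>
    (\<forall>a b. tensor_lift (\<lambda>x y. \<epsilon> x *\<^sub>C y) (the_elem_of (T1 \<Delta> a b)) = a * b) \<and>
    (\<forall>a b. tensor_lift (\<lambda>x y. \<epsilon> y *\<^sub>C x) (the_elem_of (T2 \<Delta> a b)) = a * b)"

text \<open>The antipode takes values in \<open>M(A)\<close>; the two identities are in \<open>A \<subseteq> M(A)\<close>.\<close>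

definition is_antipode ::
  "'a::complex_algebra coproduct \<Rightarrow> ('a \<Rightarrow> complex) \<Rightarrow> ('a \<Rightarrow> 'a multiplier) \<Rightarrow> bool"
  where "is_antipode \<Delta> \<epsilon> S \<longleftrightarrow> algebra_antihom S \<and>
    (\<forall>a b. tensor_lift (\<lambda>x y. S x * incl y) (the_elem_of (T1 \<Delta> a b)) = incl (\<epsilon> a *\<^sub>C b)) \<and>
    (\<forall>a b. tensor_lift (\<lambda>x y. incl x * S y) (the_elem_of (T2 \<Delta> b a)) = incl (\<epsilon> a *\<^sub>C b))"

text \<open>The antipode as a map \<open>A \<rightarrow> A\<close>, meaningful in the regular case.\<close>

definition antipode_in :: "('a::complex_algebra \<Rightarrow> 'a multiplier) \<Rightarrow> 'a \<Rightarrow> 'a"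
  where "antipode_in S a = the_elem_of (S a)"


section \<open>Group-cograded multiplier Hopf algebras\<close>

definition subalgebra :: "'a::complex_algebra set \<Rightarrow> bool"
  where "subalgebra B \<longleftrightarrow> cvec.subspace B \<and> (\<forall>x\<in>B. \<forall>y\<in>B. x * y \<in> B)"

definition has_identity :: "'a::complex_algebra set \<Rightarrow> bool"
  where "has_identity B \<longleftrightarrow> (\<exists>u\<in>B. \<forall>x\<in>B. u * x = x \<and> x * u = x)"

definition finite_dimensional :: "'a::complex_vector set \<Rightarrow> bool"
  where "finite_dimensional V \<longleftrightarrow> (\<exists>B. finite B \<and> cvec.span B = V)"

definition decomposition ::
  "('g, 'm) monoid_scheme \<Rightarrow> ('g \<Rightarrow> 'a::complex_vector set) \<Rightarrow> 'a \<Rightarrow> ('g \<Rightarrow> 'a) \<Rightarrow> bool"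
  where "decomposition G A a x \<longleftrightarrow>
    (\<forall>p\<in>carrier G. x p \<in> A p) \<and> (\<forall>p. p \<notin> carrier G \<longrightarrow> x p = 0) \<and>
    finite {p. x p \<noteq> 0} \<and> a = (\<Sum>p | x p \<noteq> 0. x p)"

definition direct_sum ::
  "('g, 'm) monoid_scheme \<Rightarrow> ('g \<Rightarrow> 'a::complex_vector set) \<Rightarrow> bool"
  where "direct_sum G A \<longleftrightarrow> (\<forall>a. \<exists>!x. decomposition G A a x)"

definition component ::
  "('g, 'm) monoid_scheme \<Rightarrow> ('g \<Rightarrow> 'a::complex_vector set) \<Rightarrow> 'g \<Rightarrow> 'a \<Rightarrow> 'a"
  where "component G A p a = (THE x. decomposition G A a x) p"

definition tensor_subspace ::
  "'a::complex_vector set \<Rightarrow> 'b::complex_vector set \<Rightarrow> ('a, 'b) tensor set"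
  where "tensor_subspace V W = cvec.span {x \<otimes>\<^sub>C y | x y. x \<in> V \<and> y \<in> W}"

definition cograded ::
  "('g, 'm) monoid_scheme \<Rightarrow> ('g \<Rightarrow> 'a::complex_algebra set) \<Rightarrow> 'a coproduct \<Rightarrow> bool"
  where "cograded G A \<Delta> \<longleftrightarrow>
    (\<forall>p\<in>carrier G. subalgebra (A p) \<and> A p \<noteq> {0}) \<and>
    direct_sum G A \<and>
    (\<forall>p\<in>carrier G. \<forall>q\<in>carrier G. p \<noteq> q \<longrightarrow> (\<forall>x\<in>A p. \<forall>y\<in>A q. x * y = 0)) \<and>
    (\<forall>p\<in>carrier G. \<forall>q\<in>carrier G.
      cvec.span {T1 \<Delta> a b | a b. a \<in> A (p \<otimes>\<^bsub>G\<^esub> q) \<and> b \<in> A q} =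
        incl ` tensor_subspace (A p) (A q) \<and>
      cvec.span {T2 \<Delta> b a | a b. a \<in> A (p \<otimes>\<^bsub>G\<^esub> q) \<and> b \<in> A p} =
        incl ` tensor_subspace (A p) (A q))"

text \<open>
  \<open>\<Delta>\<^sub>p\<^sub>,\<^sub>q(x)\<close> is the element of \<open>A\<^sub>p \<otimes> A\<^sub>q\<close> that acts on \<open>A\<^sub>p \<otimes> A\<^sub>q\<close> from both sides as
  the multiplier \<open>\<Delta>(x)\<close> does; this is the \<open>(p, q)\<close>-component of \<open>\<Delta>(x)\<close> under
  \<open>M(A \<otimes> A) = \<Prod> M(A\<^sub>p \<otimes> A\<^sub>q)\<close> and \<open>M(A\<^sub>p \<otimes> A\<^sub>q) = A\<^sub>p \<otimes> A\<^sub>q\<close> (the \<open>A\<^sub>p\<close> having identities).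
\<close>

definition coproduct_component ::
  "('g \<Rightarrow> 'a::complex_algebra set) \<Rightarrow> 'a coproduct \<Rightarrow> 'g \<Rightarrow> 'g \<Rightarrow> 'a \<Rightarrow> ('a, 'a) tensor"
  where "coproduct_component A \<Delta> p q x =
    (THE t. t \<in> tensor_subspace (A p) (A q) \<and>
      (\<forall>z\<in>tensor_subspace (A p) (A q). t * z = lmul (\<Delta> x) z \<and> z * t = rmul (\<Delta> x) z))"

text \<open>The dual space of \<open>A\<^sub>p\<close>; functionals on \<open>A\<^sub>p\<close> are extended by zero to all of \<open>A\<close>.\<close>

definition component_dual ::
  "('g, 'm) monoid_scheme \<Rightarrow> ('g \<Rightarrow> 'a::complex_vector set) \<Rightarrow> 'g \<Rightarrow> ('a \<Rightarrow> complex) set"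
  where "component_dual G A p =
    {f. clinear f \<and> (\<forall>q\<in>carrier G. q \<noteq> p \<longrightarrow> (\<forall>x\<in>A q. f x = 0))}"

text \<open>The product \<open>fg \<in> A\<^sub>p\<^sub>q'\<close> of \<open>f \<in> A\<^sub>p'\<close> and \<open>g \<in> A\<^sub>q'\<close>, again extended by zero.\<close>

definition dual_mult ::
  "('g, 'm) monoid_scheme \<Rightarrow> ('g \<Rightarrow> 'a::complex_algebra set) \<Rightarrow> 'a coproduct \<Rightarrow> 'g \<Rightarrow> 'g
    \<Rightarrow> ('a \<Rightarrow> complex) \<Rightarrow> ('a \<Rightarrow> complex) \<Rightarrow> ('a \<Rightarrow> complex)"
  where "dual_mult G A \<Delta> p q f g a =
    tensor_functional f g (coproduct_component A \<Delta> p q (component G A (p \<otimes>\<^bsub>G\<^esub> q) a))"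

definition is_basis :: "'i set \<Rightarrow> ('i \<Rightarrow> 'a::complex_vector) \<Rightarrow> 'a set \<Rightarrow> bool"
  where "is_basis I e V \<longleftrightarrow>
    inj_on e I \<and> cvec.independent (e ` I) \<and> cvec.span (e ` I) = V"

text \<open>
  \<open>\<phi>\<^sub>h(a)\<close> for \<open>h \<in> A\<^sub>e'\<close>. \<^term>\<open>sum'\<close> is the sum over the indices with non-zero summand, of which
  there are finitely many.
\<close>

definition phi ::
  "('g, 'm) monoid_scheme \<Rightarrow> ('g \<Rightarrow> 'a::complex_algebra set) \<Rightarrow> 'a coproduct
    \<Rightarrow> ('a \<Rightarrow> 'a multiplier) \<Rightarrow> ('g \<Rightarrow> 'i set) \<Rightarrow> ('g \<Rightarrow> 'i \<Rightarrow> 'a) \<Rightarrow> ('g \<Rightarrow> 'i \<Rightarrow> 'a \<Rightarrow> complex)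
    \<Rightarrow> ('a \<Rightarrow> complex) \<Rightarrow> 'a \<Rightarrow> complex"
  where "phi G A \<Delta> S I e f h a =
    sum' (\<lambda>p. \<Sum>i\<in>I p. dual_mult G A \<Delta> p \<one>\<^bsub>G\<^esub> (f p i) h
      (a * antipode_in S (antipode_in S (e p i)))) (carrier G)"

end

theory Submission
  imports Defs
begin

text \<open>
  Write \<open>q = p\<^sup>-\<^sup>1\<close> and use Sweedler notation. Since \<open>S(e\<^sub>i) S\<^sup>2(e\<^sub>j) = S(S(e\<^sub>j) e\<^sub>i)\<close>, the right-hand
  side of the formula for \<open>g(a)\<close> is
  \<open>\<Sum> (f\<^sub>j (f\<^sub>i g)) (a S(S(e\<^sub>j) e\<^sub>i))\<close>, with \<open>e\<^sub>j\<close> running through the basis of \<open>A\<^sub>p\<close> and \<open>e\<^sub>i\<close> through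
  that of \<open>A\<^sub>q\<close>. This is the trace of the operator
  \<open>x \<otimes> y \<mapsto> V(S(x) y)\<close> on \<open>A\<^sub>p \<otimes> A\<^sub>q\<close>, where \<open>V(c) = d\<^sub>1 \<otimes> d\<^sub>2 g(d\<^sub>3)\<close> for \<open>d = a S(c)\<close>. By
  cyclicity it is also the trace on \<open>A\<^sub>q\<close> of the operator
  \<open>c \<mapsto> S(d\<^sub>1) d\<^sub>2 g(d\<^sub>3) = g(a S(c)) 1\<^sub>q\<close>, whose range lies in the span of the identity \<open>1\<^sub>q\<close>; hence the trace
  is \<open>g(a S(1\<^sub>q)) = g(a 1\<^sub>p) = g(a)\<close>.

  The identity \<open>S(d\<^sub>1) d\<^sub>2 g(d\<^sub>3) = g(d) 1\<^sub>q\<close>, in terms of dual bases, is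
  \<open>antipode_contraction\<close>; cyclicity of the trace becomes the expansion of \<open>S(e\<^sub>j) e\<^sub>i\<close> in the basis
  of \<open>A\<^sub>q\<close> and an exchange of sums. The lemmas before it carry the axioms, which are stated for
  multipliers, over to the components \<open>\<Delta>\<^sub>p\<^sub>,\<^sub>q\<close>: the identities \<open>1\<^sub>q\<close> turn
  \<open>\<Delta>(x)(1 \<otimes> b)\<close> and \<open>(a \<otimes> 1)\<Delta>(x)\<close> into \<open>\<Delta>\<^sub>p\<^sub>,\<^sub>q(x)\<close> itself (\<open>coproduct_component\<close>), which gives the
  counit law \<open>cop_counit\<close>, the antipode law \<open>cop_antipode\<close> and coassociativity \<open>cop_coassoc\<close>. The
  antipode maps \<open>A\<^sub>p\<close> into \<open>A\<^sub>q\<close> because \<open>S(x) y\<close> is computed by the antipode axiom for \<open>y\<close> in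
  every component (\<open>S_in\<close>), and it maps \<open>1\<^sub>p\<close> to \<open>1\<^sub>q\<close> (\<open>T_unit\<close>).

  The last claim follows: some \<open>g\<close> takes a non-zero value, so some \<open>\<phi>\<^sub>h\<close> in the formula
  does not vanish.
\<close>

section \<open>Tensor products and multipliers\<close>

lemma linear_eq_on_tensor_subspace:
  assumes "clinear F" "clinear H" "\<And>x y. \<lbrakk>x \<in> V; y \<in> W\<rbrakk> \<Longrightarrow> F (x \<otimes>\<^sub>C y) = H (x \<otimes>\<^sub>C y)"
    and "t \<in> tensor_subspace V W"
  shows "F t = H t"
  using assms(4) unfolding tensor_subspace_def
  by (induction rule: cvec.span_induct_alt)
    (auto simp: clinearD [OF assms(1)] clinearD [OF assms(2)] assms(3))

lemma tens_in_tensor_subspace: "\<lbrakk>x \<in> V; y \<in> W\<rbrakk> \<Longrightarrow> x \<otimes>\<^sub>C y \<in> tensor_subspace V W"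
  unfolding tensor_subspace_def by (rule cvec.span_base) blast

lemma tensor_map_tensor_map:
  assumes "clinear f" "clinear g" "clinear f'" "clinear g'"
  shows "tensor_map f g (tensor_map f' g' t) = tensor_map (\<lambda>x. f (f' x)) (\<lambda>y. g (g' y)) t"
proof -
  have "clinear (\<lambda>x. f (f' x))" "clinear (\<lambda>y. g (g' y))"
    using assms by (simp_all add: clinear_iff)
  then show ?thesis
    by (induction t) (simp_all add: assms tensor_map_tens clinearD [OF clinear_tensor_map])
qed

lemma mult_tens_mult: "(m \<otimes>\<^sub>M n) * (m' \<otimes>\<^sub>M n') = (m * m') \<otimes>\<^sub>M (n * n')"
  by (rule multiplier_eqI)
    (simp_all add: lmul_simps rmul_simps lmul_mult_tens rmul_mult_tens fun_eq_iff
      tensor_map_tensor_map multiplier_laws)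

lemma mult_incl: "m * incl a = incl (lmul m a)"
  by (rule multiplier_eqI)
    (simp_all add: lmul_simps rmul_simps lmul_incl rmul_incl fun_eq_iff multiplier_laws)

lemma mult_transport_incl:
  assumes "algebra_iso \<theta>"
  shows "mult_transport \<theta> (incl a) = incl (\<theta> a)"
  by (rule multiplier_eqI; use assms in transfer)
    (auto simp: fun_eq_iff algebra_iso_def bij_is_surj surj_f_inv_f)

text \<open>
  Local units make \<open>incl\<close> injective on iterated tensor products, where the elements of
  \<open>M(A \<otimes> A)\<close> and \<open>M(A \<otimes> (A \<otimes> A))\<close> that occur in the axioms have to be identified with tensors.
  One unit for a whole finite set of elements is asked for, since this form passes to tensor products.
\<close>

definition left_local_units :: "'a::complex_algebra set \<Rightarrow> bool"
  where "left_local_units B \<longleftrightarrow>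
    (\<forall>X. finite X \<longrightarrow> X \<subseteq> B \<longrightarrow> (\<exists>u\<in>B. \<forall>x\<in>X. u * x = x))"

lemma inj_incl_left_local_units:
  assumes "left_local_units (UNIV :: 'a set)"
  shows "inj (incl :: 'a::complex_algebra \<Rightarrow> _)"
proof (rule injI)
  fix s t :: 'a
  assume "incl s = incl t"
  then have "rmul (incl s) = rmul (incl t)" by simp
  then have z: "z * (s - t) = 0" for z
    by (simp add: rmul_incl fun_eq_iff right_diff_distrib)
  obtain u where "u * (s - t) = s - t"
    using assms unfolding left_local_units_def by (metis finite.emptyI finite_insert insertI1 subset_UNIV)
  then show "s = t" using z by simp
qed

lemma tensor_finite_legs:
  fixes t :: "('a::complex_algebra, 'b::complex_algebra) tensor"
  shows "\<exists>X Y. finite X \<and> finite Y \<and>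
    (\<forall>u v. (\<forall>x\<in>X. u * x = x) \<longrightarrow> (\<forall>y\<in>Y. v * y = y) \<longrightarrow> (u \<otimes>\<^sub>C v) * t = t)"
proof (induction t)
  case (tens a b)
  show ?case by (rule exI [of _ "{a}"], rule exI [of _ "{b}"]) (simp add: tens_times_tens)
next
  case (add s t)
  then obtain X Y X' Y' where "finite X" "finite Y" "finite X'" "finite Y'"
    "\<forall>u v. (\<forall>x\<in>X. u * x = x) \<longrightarrow> (\<forall>y\<in>Y. v * y = y) \<longrightarrow> (u \<otimes>\<^sub>C v) * s = s"
    "\<forall>u v. (\<forall>x\<in>X'. u * x = x) \<longrightarrow> (\<forall>y\<in>Y'. v * y = y) \<longrightarrow> (u \<otimes>\<^sub>C v) * t = t"
    by blast
  then show ?case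
    by (intro exI [of _ "X \<union> X'"] exI [of _ "Y \<union> Y'"]) (simp add: distrib_left)
qed

lemma left_local_units_tensor:
  assumes "left_local_units (UNIV :: 'a set)" "left_local_units (UNIV :: 'b set)"
  shows "left_local_units (UNIV :: ('a::complex_algebra, 'b::complex_algebra) tensor set)"
  unfolding left_local_units_def
proof (intro allI impI)
  fix Z :: "('a, 'b) tensor set"
  assume "finite Z"
  obtain X Y where XY: "\<And>t. finite (X t)" "\<And>t. finite (Y t)"
    "\<And>t u v. \<lbrakk>\<forall>x\<in>X t. u * x = x; \<forall>y\<in>Y t. v * y = y\<rbrakk> \<Longrightarrow> (u \<otimes>\<^sub>C v) * t = (t :: ('a, 'b) tensor)"
    using tensor_finite_legs by metis
  have fin: "finite (\<Union>t\<in>Z. X t)" "finite (\<Union>t\<in>Z. Y t)" using XY \<open>finite Z\<close> by auto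
  obtain u where "\<forall>x\<in>(\<Union>t\<in>Z. X t). u * x = x"
    using assms(1) fin(1) unfolding left_local_units_def by blast
  moreover obtain v where "\<forall>y\<in>(\<Union>t\<in>Z. Y t). v * y = y"
    using assms(2) fin(2) unfolding left_local_units_def by blast
  ultimately show "\<exists>w\<in>UNIV. \<forall>t\<in>Z. w * t = t"
    using XY(3) by (intro bexI [of _ "u \<otimes>\<^sub>C v"]) auto
qed

lemma clinear_sum: "clinear f \<Longrightarrow> f (\<Sum>i\<in>X. g i) = (\<Sum>i\<in>X. f (g i))"
  by (induction X rule: infinite_finite_induct) (simp_all add: clinearD)

lemma basis_expansion:
  assumes b: "is_basis X b V" and X: "finite X"
    and f: "\<And>i. i \<in> X \<Longrightarrow> clinear (f i)"
    and d: "\<And>i j. \<lbrakk>i \<in> X; j \<in> X\<rbrakk> \<Longrightarrow> f i (b j) = (if i = j then 1 else 0)"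
    and v: "v \<in> V"
  shows "v = (\<Sum>i\<in>X. f i v *\<^sub>C b i)"
proof -
  have "v \<in> cvec.span (b ` X)" using b v by (simp add: is_basis_def)
  then show ?thesis
  proof (induction rule: cvec.span_induct_alt)
    case base
    show ?case by (simp add: clinearD(3) [OF f])
  next
    case (step c x y)
    then obtain j where j: "j \<in> X" "x = b j" by blast
    have "(\<Sum>i\<in>X. f i (c *\<^sub>C x + y) *\<^sub>C b i) =
        c *\<^sub>C (\<Sum>i\<in>X. f i x *\<^sub>C b i) + (\<Sum>i\<in>X. f i y *\<^sub>C b i)"
      by (simp add: clinearD [OF f] scaleC_add_left scaleC_scaleC sum.distrib
          cvec.scale_sum_right scaleC_complex_def)
    moreover have "(\<Sum>i\<in>X. f i x *\<^sub>C b i) = (\<Sum>i\<in>X. if i = j then b i else 0)"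
      using j by (intro sum.cong) (auto simp: d scaleC_one)
    ultimately show ?case using step j X by simp
  qed
qed

section \<open>Cograded multiplier Hopf algebras with unital components\<close>

locale unital_cograded = group G for G :: "('g, 'm) monoid_scheme" (structure) +
  fixes \<Delta> :: "'a::complex_algebra coproduct" and A :: "'g \<Rightarrow> 'a set"
    and \<epsilon> :: "'a \<Rightarrow> complex" and S :: "'a \<Rightarrow> 'a multiplier"
  assumes mha: "multiplier_hopf_algebra \<Delta>"
    and cog: "cograded G A \<Delta>"
    and unital: "\<And>p. p \<in> carrier G \<Longrightarrow> has_identity (A p)"
    and counit: "is_counit \<Delta> \<epsilon>"
    and antipode: "is_antipode \<Delta> \<epsilon> S"
begin

definition unit :: "'g \<Rightarrow> 'a"
  where "unit p = (SOME u. u \<in> A p \<and> (\<forall>x\<in>A p. u * x = x \<and> x * u = x))"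

lemma unit:
  assumes "p \<in> carrier G"
  shows "unit p \<in> A p" "\<And>x. x \<in> A p \<Longrightarrow> unit p * x = x" "\<And>x. x \<in> A p \<Longrightarrow> x * unit p = x"
proof -
  have "\<exists>u. u \<in> A p \<and> (\<forall>x\<in>A p. u * x = x \<and> x * u = x)"
    using unital [OF assms] by (auto simp: has_identity_def)
  from someI_ex [OF this]
  show "unit p \<in> A p" "\<And>x. x \<in> A p \<Longrightarrow> unit p * x = x" "\<And>x. x \<in> A p \<Longrightarrow> x * unit p = x"
    unfolding unit_def by blast+
qed

lemma subspace_A: "p \<in> carrier G \<Longrightarrow> cvec.subspace (A p)"
  and mult_A_0: "\<lbrakk>p \<in> carrier G; q \<in> carrier G; p \<noteq> q; x \<in> A p; y \<in> A q\<rbrakk> \<Longrightarrow> x * y = 0"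
  and A_nontrivial: "p \<in> carrier G \<Longrightarrow> A p \<noteq> {0}"
  using cog by (auto simp: cograded_def subalgebra_def)

lemma unit_nonzero:
  assumes "p \<in> carrier G"
  shows "unit p \<noteq> 0"
proof
  assume "unit p = 0"
  then have "x = 0" if "x \<in> A p" for x using unit(2) [OF assms that] by simp
  then show False
    using A_nontrivial [OF assms] cvec.subspace_0 [OF subspace_A [OF assms]] by auto
qed

text \<open>
  As \<open>A\<^sub>r A\<^sub>p = 0\<close> for \<open>p \<noteq> r\<close>, the projection of \<open>A\<close> onto \<open>A\<^sub>r\<close> is multiplication by the identity
  of \<open>A\<^sub>r\<close>. So it is linear, this identity is central in \<open>A\<close>, and \<open>A\<^sub>r\<close> is an ideal.
\<close>

lemma decomposition_unit:
  assumes x: "decomposition G A a x" and r: "r \<in> carrier G"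
  shows "unit r * a = x r" "a * unit r = x r"
proof -
  have x: "\<And>p. p \<in> carrier G \<Longrightarrow> x p \<in> A p" "\<And>p. p \<notin> carrier G \<Longrightarrow> x p = 0"
    "finite {p. x p \<noteq> 0}" and a: "a = (\<Sum>p | x p \<noteq> 0. x p)"
    using x by (auto simp: decomposition_def)
  have 1: "unit r * x p = (if p = r then x r else 0)" "x p * unit r = (if p = r then x r else 0)"
    for p
    using x(1) [of p] x(2) [of p] unit [OF r] mult_A_0 [of r p] mult_A_0 [of p r] r
    by (cases "p \<in> carrier G"; auto)+
  show "unit r * a = x r" "a * unit r = x r"
    unfolding a sum_distrib_left sum_distrib_right using x(3) by (simp_all add: 1)
qed

lemma decomposition_component: "decomposition G A a (\<lambda>p. component G A p a)"
proof -
  have "\<exists>!x. decomposition G A a x" using cog by (simp add: cograded_def direct_sum_def)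
  then show ?thesis unfolding component_def by (rule theI')
qed

lemma component_eq: "r \<in> carrier G \<Longrightarrow> component G A r a = unit r * a"
  and unit_central: "r \<in> carrier G \<Longrightarrow> unit r * a = a * unit r"
  using decomposition_unit [OF decomposition_component] by simp_all

lemma component_in: "r \<in> carrier G \<Longrightarrow> unit r * a \<in> A r"
  using decomposition_component [of a] by (simp add: decomposition_def component_eq)

lemma A_left_ideal: "\<lbrakk>r \<in> carrier G; x \<in> A r\<rbrakk> \<Longrightarrow> a * x \<in> A r"
  using component_in [of r "a * x"] unit_central [of r "a * x"] unit(3) [of r x]
  by (simp add: mult.assoc)

lemma component_induct [case_names zero add comp]:
  assumes "P 0" "\<And>x y. \<lbrakk>P x; P y\<rbrakk> \<Longrightarrow> P (x + y)" "\<And>p x. \<lbrakk>p \<in> carrier G; x \<in> A p\<rbrakk> \<Longrightarrow> P x"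
  shows "P a"
proof -
  let ?x = "\<lambda>p. component G A p a"
  have d: "decomposition G A a ?x" by (rule decomposition_component)
  have "P (\<Sum>p\<in>F. ?x p)" for F
  proof (induction F rule: infinite_finite_induct)
    case (insert p F)
    have "P (?x p)"
      using d assms(1) assms(3) [of p "?x p"] by (cases "p \<in> carrier G") (auto simp: decomposition_def)
    then show ?case using insert assms(2) by simp
  qed (simp_all add: assms(1))
  then show ?thesis using d unfolding decomposition_def by metis
qed

text \<open>The sum of the identities of finitely many components is a unit for all elements they support.\<close>

lemma left_local_units_A: "left_local_units (UNIV :: 'a set)"
proof -
  let ?c = "\<lambda>a p. component G A p a"
  have "(\<Sum>p\<in>F. unit p) * a = a" if F: "finite F" "{p. ?c a p \<noteq> 0} \<subseteq> F" "F \<subseteq> carrier G" for F a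
  proof -
    have "(\<Sum>p\<in>F. unit p) * a = (\<Sum>p\<in>F. ?c a p)"
      unfolding sum_distrib_right by (rule sum.cong) (use F in \<open>auto simp: component_eq\<close>)
    also have "\<dots> = (\<Sum>p | ?c a p \<noteq> 0. ?c a p)"
      by (rule sum.mono_neutral_right) (use F in auto)
    also have "\<dots> = a"
      using decomposition_component [of a] by (simp add: decomposition_def)
    finally show ?thesis .
  qed
  moreover have "finite (\<Union>a\<in>X. {p. ?c a p \<noteq> 0})" "(\<Union>a\<in>X. {p. ?c a p \<noteq> 0}) \<subseteq> carrier G"
    if "finite X" for X
    using that decomposition_component by (auto simp: decomposition_def)
  ultimately show ?thesis
    unfolding left_local_units_def by (meson UN_upper UNIV_I)
qed

lemma inj_incl_tensor:
  "inj (incl :: ('a, 'a) tensor \<Rightarrow> _)" "inj (incl :: ('a, ('a, 'a) tensor) tensor \<Rightarrow> _)"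
  by (intro inj_incl_left_local_units left_local_units_tensor left_local_units_A)+

lemma inj_incl_A: "inj (incl :: 'a \<Rightarrow> _)"
  using mha by (simp add: multiplier_hopf_algebra_def inj_incl)

lemma the_elem_of_incl:
  "the_elem_of (incl a) = (a :: 'a)" "the_elem_of (incl t) = (t :: ('a, 'a) tensor)"
  by (simp_all add: the_elem_of_def inv_into_f_f inj_incl_A inj_incl_tensor)

section \<open>The components of the coproduct\<close>

lemma T1_in:
  "\<lbrakk>p \<in> carrier G; q \<in> carrier G; x \<in> A (p \<otimes> q); b \<in> A q\<rbrakk>
    \<Longrightarrow> T1 \<Delta> x b \<in> incl ` tensor_subspace (A p) (A q)"
  and T2_in:
  "\<lbrakk>p \<in> carrier G; q \<in> carrier G; x \<in> A (p \<otimes> q); c \<in> A p\<rbrakk>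
    \<Longrightarrow> T2 \<Delta> c x \<in> incl ` tensor_subspace (A p) (A q)"
proof -
  assume pq: "p \<in> carrier G" "q \<in> carrier G" and x: "x \<in> A (p \<otimes> q)"
  have "T1 \<Delta> x b \<in> cvec.span {T1 \<Delta> a b | a b. a \<in> A (p \<otimes> q) \<and> b \<in> A q}" if "b \<in> A q"
    by (rule cvec.span_base) (use x that in blast)
  then show "b \<in> A q \<Longrightarrow> T1 \<Delta> x b \<in> incl ` tensor_subspace (A p) (A q)"
    using cog pq unfolding cograded_def by blast
  have "T2 \<Delta> c x \<in> cvec.span {T2 \<Delta> b a | a b. a \<in> A (p \<otimes> q) \<and> b \<in> A p}" if "c \<in> A p"
    by (rule cvec.span_base) (use x that in blast)
  then show "c \<in> A p \<Longrightarrow> T2 \<Delta> c x \<in> incl ` tensor_subspace (A p) (A q)"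
    using cog pq unfolding cograded_def by blast
qed

lemma tensor_units:
  assumes pq: "p \<in> carrier G" "q \<in> carrier G" and z: "z \<in> tensor_subspace (A p) (A q)"
  shows "(unit p \<otimes>\<^sub>C unit q) * z = z" "z * (unit p \<otimes>\<^sub>C unit q) = z"
    "lmul (1 \<otimes>\<^sub>M incl (unit q)) z = z" "rmul (incl (unit p) \<otimes>\<^sub>M 1) z = z"
proof -
  note unit [OF pq(1), simp] unit [OF pq(2), simp]
  show "(unit p \<otimes>\<^sub>C unit q) * z = z"
    by (rule linear_eq_on_tensor_subspace [OF clinear_mult_left _ _ z])
      (simp_all add: clinear_iff tens_times_tens)
  show "z * (unit p \<otimes>\<^sub>C unit q) = z"
    by (rule linear_eq_on_tensor_subspace [OF clinear_mult_right _ _ z])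
      (simp_all add: clinear_iff tens_times_tens)
  show "lmul (1 \<otimes>\<^sub>M incl (unit q)) z = z"
    by (rule linear_eq_on_tensor_subspace [OF multiplier_laws(1) _ _ z])
      (simp_all add: clinear_iff lmul_mult_tens tensor_map_tens lmul_simps lmul_incl
        algebra_simps mult_scaleC_right)
  show "rmul (incl (unit p) \<otimes>\<^sub>M 1) z = z"
    by (rule linear_eq_on_tensor_subspace [OF multiplier_laws(2) _ _ z])
      (simp_all add: clinear_iff rmul_mult_tens tensor_map_tens rmul_simps rmul_incl
        algebra_simps mult_scaleC_left)
qed

text \<open>
  Both \<open>\<Delta>(x)(1 \<otimes> 1\<^sub>q)\<close> and \<open>(1\<^sub>p \<otimes> 1)\<Delta>(x)\<close> lie in \<open>A\<^sub>p \<otimes> A\<^sub>q\<close>. The first acts there from the left as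
  \<open>\<Delta>(x)\<close> does and the second from the right; compressing with the identity \<open>1\<^sub>p \<otimes> 1\<^sub>q\<close> shows that they
  coincide, so their common value is \<open>\<Delta>\<^sub>p\<^sub>,\<^sub>q(x)\<close>.
\<close>

lemma coproduct_component:
  assumes pq: "p \<in> carrier G" "q \<in> carrier G" and x: "x \<in> A (p \<otimes> q)"
  shows "coproduct_component A \<Delta> p q x \<in> tensor_subspace (A p) (A q)"
    "incl (coproduct_component A \<Delta> p q x) = T1 \<Delta> x (unit q)"
    "incl (coproduct_component A \<Delta> p q x) = T2 \<Delta> (unit p) x"
proof -
  let ?V = "tensor_subspace (A p) (A q)" and ?u = "unit p \<otimes>\<^sub>C unit q"
  obtain t t' where t: "t \<in> ?V" "T1 \<Delta> x (unit q) = incl t"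
    and t': "t' \<in> ?V" "T2 \<Delta> (unit p) x = incl t'"
    using T1_in [OF pq x unit(1) [OF pq(2)]] T2_in [OF pq x unit(1) [OF pq(1)]] by blast
  have u: "?u \<in> ?V" by (intro tens_in_tensor_subspace unit pq)
  have 1: "t * z = lmul (\<Delta> x) z" if "z \<in> ?V" for z
  proof -
    have "t * z = lmul (incl t) z" by (simp add: lmul_incl)
    also have "\<dots> = lmul (\<Delta> x) (lmul (1 \<otimes>\<^sub>M incl (unit q)) z)"
      by (simp add: t(2) [symmetric] T1_def lmul_simps)
    finally show ?thesis by (simp add: tensor_units [OF pq that])
  qed
  have 2: "z * t' = rmul (\<Delta> x) z" if "z \<in> ?V" for z
  proof -
    have "z * t' = rmul (incl t') z" by (simp add: rmul_incl)
    also have "\<dots> = rmul (\<Delta> x) (rmul (incl (unit p) \<otimes>\<^sub>M 1) z)"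
      by (simp add: t'(2) [symmetric] T2_def rmul_simps)
    finally show ?thesis by (simp add: tensor_units [OF pq that])
  qed
  have "t = ?u * (t * ?u)" by (simp add: tensor_units [OF pq t(1)])
  also have "\<dots> = (?u * t') * ?u" by (simp add: 1 2 u multiplier_laws(5))
  also have "\<dots> = t'" by (simp add: tensor_units [OF pq t'(1)])
  finally have tt': "t = t'" .
  have "coproduct_component A \<Delta> p q x = t"
    unfolding coproduct_component_def
  proof (rule the_equality)
    show "t \<in> ?V \<and> (\<forall>z\<in>?V. t * z = lmul (\<Delta> x) z \<and> z * t = rmul (\<Delta> x) z)"
      using t(1) 1 2 tt' by blast
    show "s = t" if "s \<in> ?V \<and> (\<forall>z\<in>?V. s * z = lmul (\<Delta> x) z \<and> z * s = rmul (\<Delta> x) z)" for s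
      using that 1 [OF u] tensor_units(2) [OF pq, of s] tensor_units(2) [OF pq t(1)] u by metis
  qed
  then show "coproduct_component A \<Delta> p q x \<in> ?V"
    "incl (coproduct_component A \<Delta> p q x) = T1 \<Delta> x (unit q)"
    "incl (coproduct_component A \<Delta> p q x) = T2 \<Delta> (unit p) x"
    using t t' tt' by simp_all
qed

text \<open>
  The map \<open>\<Delta>\<^sub>p\<^sub>,\<^sub>q\<close> composed with the projection onto \<open>A\<^sub>p\<^sub>q\<close>: in this way it is linear on all of \<open>A\<close> and
  can be used as an argument of \<^const>\<open>tensor_map\<close>.
\<close>

definition cop :: "'g \<Rightarrow> 'g \<Rightarrow> 'a \<Rightarrow> ('a, 'a) tensor"
  where "cop p q x = coproduct_component A \<Delta> p q (component G A (p \<otimes> q) x)"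

lemma dual_mult_eq: "dual_mult G A \<Delta> p q f g a = tensor_functional f g (cop p q a)"
  by (simp add: dual_mult_def cop_def)

lemma cop_in: "\<lbrakk>p \<in> carrier G; q \<in> carrier G\<rbrakk> \<Longrightarrow> cop p q x \<in> tensor_subspace (A p) (A q)"
  by (simp add: cop_def component_eq coproduct_component component_in)

lemma incl_cop:
  assumes "p \<in> carrier G" "q \<in> carrier G" "x \<in> A (p \<otimes> q)"
  shows "incl (cop p q x) = T1 \<Delta> x (unit q)" "incl (cop p q x) = T2 \<Delta> (unit p) x"
    "the_elem_of (T1 \<Delta> x (unit q)) = cop p q x" "the_elem_of (T2 \<Delta> (unit p) x) = cop p q x"
proof -
  have "component G A (p \<otimes> q) x = x" using assms by (simp add: component_eq unit)
  then show 1: "incl (cop p q x) = T1 \<Delta> x (unit q)" "incl (cop p q x) = T2 \<Delta> (unit p) x"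
    using coproduct_component [OF assms] by (simp_all only: cop_def)
  show "the_elem_of (T1 \<Delta> x (unit q)) = cop p q x" "the_elem_of (T2 \<Delta> (unit p) x) = cop p q x"
    by (simp_all only: 1 [symmetric] the_elem_of_incl)
qed

lemma clinear_Delta: "clinear \<Delta>"
  using mha by (simp add: multiplier_hopf_algebra_def algebra_hom_def)

lemma clinear_cop:
  assumes pq: "p \<in> carrier G" "q \<in> carrier G"
  shows "clinear (cop p q)"
proof -
  have 1: "incl (cop p q x) = T1 \<Delta> (unit (p \<otimes> q) * x) (unit q)" for x
    using pq by (simp add: cop_def component_eq coproduct_component component_in)
  have T1: "T1 \<Delta> (x + y) b = T1 \<Delta> x b + T1 \<Delta> y b" "T1 \<Delta> (c *\<^sub>C x) b = c *\<^sub>C T1 \<Delta> x b" for x y b c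
    using cbilinear_T1 [OF clinear_Delta] by (auto simp: cbilinear_def clinear_iff)
  show ?thesis
    by (rule clinearI; rule injD [OF inj_incl_tensor(1)])
      (simp_all add: clinearD [OF clinear_incl] 1 distrib_left mult_scaleC_right T1)
qed

lemma cop_other:
  assumes "p \<in> carrier G" "q \<in> carrier G" "r \<in> carrier G" "r \<noteq> p \<otimes> q" "x \<in> A r"
  shows "cop p q x = 0"
proof -
  have "component G A (p \<otimes> q) x = 0"
    using assms by (simp add: component_eq mult_A_0 [of "p \<otimes> q" r] unit)
  then have "cop p q x = cop p q 0" using assms by (simp add: cop_def component_eq)
  then show ?thesis using assms by (simp add: clinearD [OF clinear_cop])
qed

text \<open>
  This is the coassociativity axiom at \<open>a = 1\<^sub>p\<close>, \<open>b = x\<close>, \<open>c = 1\<^sub>r\<close>. The remaining factors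
  \<open>(1\<^sub>p \<otimes> 1)\<Delta>(y)\<close> with \<open>y\<close> in \<open>A\<^sub>p\<^sub>q\<close>, and \<open>\<Delta>(z)(1 \<otimes> 1\<^sub>r)\<close> with \<open>z\<close> in \<open>A\<^sub>q\<^sub>r\<close>, are again
  components of the coproduct, so both sides are multiplications by tensors.
\<close>

lemma cop_coassoc:
  assumes pqr: "p \<in> carrier G" "q \<in> carrier G" "r \<in> carrier G" and x: "x \<in> A (p \<otimes> q \<otimes> r)"
  shows "tensor_assoc (tensor_map (cop p q) (\<lambda>y. y) (cop (p \<otimes> q) r x)) =
    tensor_map (\<lambda>y. y) (cop q r) (cop p (q \<otimes> r) x)"
proof -
  note pqr [simp]
  have id: "clinear (\<lambda>y. y)" by (simp add: clinear_iff)
  have incl: "incl (a + b) = incl a + incl b" "incl (c *\<^sub>C a) = c *\<^sub>C incl a" "incl 0 = 0"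
    for a b :: "'c::complex_algebra" and c
    by (simp_all add: clinearD [OF clinear_incl])
  have bil: "(m + m') \<otimes>\<^sub>M n = m \<otimes>\<^sub>M n + m' \<otimes>\<^sub>M n" "m \<otimes>\<^sub>M (n + n') = m \<otimes>\<^sub>M n + m \<otimes>\<^sub>M n'"
    "(c *\<^sub>C m) \<otimes>\<^sub>M n = c *\<^sub>C (m \<otimes>\<^sub>M n)" "m \<otimes>\<^sub>M (c *\<^sub>C n) = c *\<^sub>C (m \<otimes>\<^sub>M n)"
    for m m' :: "'b::complex_algebra multiplier" and n n' :: "'c::complex_algebra multiplier" and c
    using cbilinear_mult_tens [where 'a = 'b and 'b = 'c]
    by (auto simp: cbilinear_def clinear_iff)
  have b1: "cbilinear (\<lambda>x y. \<Delta> x \<otimes>\<^sub>M incl y)" and b2: "cbilinear (\<lambda>x y. incl x \<otimes>\<^sub>M \<Delta> y)"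
    by (rule cbilinearI; simp add: clinearD [OF clinear_Delta] incl bil)+
  have L: "((incl (unit p) \<otimes>\<^sub>M 1) \<otimes>\<^sub>M 1) * tensor_lift (\<lambda>x y. \<Delta> x \<otimes>\<^sub>M incl y) (cop (p \<otimes> q) r x) =
      incl (tensor_map (cop p q) (\<lambda>y. y) (cop (p \<otimes> q) r x))"
  proof (rule linear_eq_on_tensor_subspace [OF _ _ _ cop_in [OF m_closed [OF pqr(1,2)] pqr(3)]])
    show "((incl (unit p) \<otimes>\<^sub>M 1) \<otimes>\<^sub>M 1) * tensor_lift (\<lambda>x y. \<Delta> x \<otimes>\<^sub>M incl y) (a \<otimes>\<^sub>C b) =
      incl (tensor_map (cop p q) (\<lambda>y. y) (a \<otimes>\<^sub>C b))" if "a \<in> A (p \<otimes> q)" "b \<in> A r" for a b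
      using incl_cop(2) [OF pqr(1,2) that(1)]
      by (simp add: b1 mult_tens_mult tensor_map_tens clinear_cop id T2_def
          flip: mult_tens_incl)
  qed (simp_all add: clinear_iff clinearD [OF clinear_tensor_lift] clinearD [OF clinear_tensor_map]
      incl distrib_left mult_scaleC_right)
  have R: "tensor_lift (\<lambda>x y. incl x \<otimes>\<^sub>M \<Delta> y) (cop p (q \<otimes> r) x) * (1 \<otimes>\<^sub>M 1 \<otimes>\<^sub>M incl (unit r)) =
      incl (tensor_map (\<lambda>y. y) (cop q r) (cop p (q \<otimes> r) x))"
  proof (rule linear_eq_on_tensor_subspace [OF _ _ _ cop_in [OF pqr(1) m_closed [OF pqr(2,3)]]])
    show "tensor_lift (\<lambda>x y. incl x \<otimes>\<^sub>M \<Delta> y) (a \<otimes>\<^sub>C b) * (1 \<otimes>\<^sub>M 1 \<otimes>\<^sub>M incl (unit r)) =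
      incl (tensor_map (\<lambda>y. y) (cop q r) (a \<otimes>\<^sub>C b))" if "a \<in> A p" "b \<in> A (q \<otimes> r)" for a b
      using incl_cop(1) [OF pqr(2,3) that(2)]
      by (simp add: b2 mult_tens_mult tensor_map_tens clinear_cop id T1_def
          flip: mult_tens_incl)
  qed (simp_all add: clinear_iff clinearD [OF clinear_tensor_lift] clinearD [OF clinear_tensor_map]
      incl distrib_right mult_scaleC_left)
  have x': "x \<in> A (p \<otimes> (q \<otimes> r))" using x by (simp add: m_assoc)
  have "coassociative \<Delta>" using mha by (simp add: multiplier_hopf_algebra_def)
  then have "mult_transport tensor_assoc (((incl (unit p) \<otimes>\<^sub>M 1) \<otimes>\<^sub>M 1) *
      tensor_lift (\<lambda>x y. \<Delta> x \<otimes>\<^sub>M incl y) (the_elem_of (T1 \<Delta> x (unit r)))) =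
    tensor_lift (\<lambda>x y. incl x \<otimes>\<^sub>M \<Delta> y) (the_elem_of (T2 \<Delta> (unit p) x)) *
      (1 \<otimes>\<^sub>M 1 \<otimes>\<^sub>M incl (unit r))"
    unfolding coassociative_def by blast
  then have "incl (tensor_assoc (tensor_map (cop p q) (\<lambda>y. y) (cop (p \<otimes> q) r x))) =
      incl (tensor_map (\<lambda>y. y) (cop q r) (cop p (q \<otimes> r) x))"
    using incl_cop(3) [OF _ pqr(3) x] incl_cop(4) [OF pqr(1) _ x']
    by (simp add: L R mult_transport_incl algebra_iso_tensor_assoc)
  then show ?thesis by (rule injD [OF inj_incl_tensor(2)])
qed

section \<open>The antipode on the components\<close>

text \<open>
  The counit and the antipode are only specified through their effect on \<open>\<Delta>(a)(1 \<otimes> b)\<close>. These elements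
  span \<open>A\<^sub>p \<otimes> A\<^sub>q\<close>, so linear conditions on simple tensors can be read off from that.
\<close>

lemma T1_induct:
  assumes pq: "p \<in> carrier G" "q \<in> carrier G" and t: "t \<in> tensor_subspace (A p) (A q)"
    and F: "clinear F" and V: "cvec.subspace V"
    and T1: "\<And>a b. \<lbrakk>a \<in> A (p \<otimes> q); b \<in> A q\<rbrakk> \<Longrightarrow> F (the_elem_of (T1 \<Delta> a b)) \<in> V"
  shows "F t \<in> V"
proof -
  have "incl t \<in> cvec.span {T1 \<Delta> a b | a b. a \<in> A (p \<otimes> q) \<and> b \<in> A q}"
    using cog pq t unfolding cograded_def by blast
  then have "\<exists>s. incl t = incl s \<and> F s \<in> V"
  proof (induction rule: cvec.span_induct_alt)
    case base
    show ?case
      by (rule exI [of _ 0]) (simp add: clinearD [OF F] clinearD [OF clinear_incl]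
          cvec.subspace_0 [OF V])
  next
    case (step c x y)
    then obtain a b s where s: "y = incl s" "F s \<in> V"
      and ab: "x = T1 \<Delta> a b" "a \<in> A (p \<otimes> q)" "b \<in> A q"
      by blast
    obtain r where r: "T1 \<Delta> a b = incl r" using T1_in [OF pq ab(2,3)] by blast
    have "F r \<in> V" using T1 [OF ab(2,3)] by (simp add: r the_elem_of_incl)
    then show ?case
      by (intro exI [of _ "c *\<^sub>C r + s"])
        (simp add: clinearD [OF F] clinearD [OF clinear_incl] ab r s cvec.subspace_add [OF V]
          cvec.subspace_scale [OF V])
  qed
  then show ?thesis using injD [OF inj_incl_tensor(1)] by metis
qed

lemma clinear_counit: "clinear \<epsilon>"
  using counit by (simp add: is_counit_def algebra_hom_def)

lemma cbilinear_counit: "cbilinear (\<lambda>x y. \<epsilon> x *\<^sub>C (y :: 'a))"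
  by (rule cbilinearI) (simp_all add: clinearD [OF clinear_counit] scaleC_add_left scaleC_add_right
      scaleC_scaleC scaleC_complex_def mult.commute)

text \<open>
  On \<open>A\<^sub>p \<otimes> A\<^sub>e\<close> the map \<open>\<epsilon> \<otimes> \<iota>\<close> sends the spanning elements \<open>\<Delta>(a)(1 \<otimes> b)\<close> to \<open>a b\<close> with \<open>a\<close> in
  \<open>A\<^sub>p\<close> and \<open>b\<close> in \<open>A\<^sub>e\<close>, and such products vanish.
\<close>

lemma counit_other:
  assumes p: "p \<in> carrier G" "p \<noteq> \<one>" and x: "x \<in> A p"
  shows "\<epsilon> x = 0"
proof -
  have "tensor_lift (\<lambda>x y. \<epsilon> x *\<^sub>C y) (x \<otimes>\<^sub>C unit \<one>) \<in> {0}"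
  proof (rule T1_induct)
    show "x \<otimes>\<^sub>C unit \<one> \<in> tensor_subspace (A p) (A \<one>)"
      by (intro tens_in_tensor_subspace x unit one_closed)
    show "tensor_lift (\<lambda>x y. \<epsilon> x *\<^sub>C y) (the_elem_of (T1 \<Delta> a b)) \<in> {0}"
      if "a \<in> A (p \<otimes> \<one>)" "b \<in> A \<one>" for a b
      using counit that p mult_A_0 [of p \<one> a b] by (simp add: is_counit_def)
  qed (simp_all add: p clinear_tensor_lift)
  then show ?thesis using unit_nonzero by (simp add: cbilinear_counit)
qed

lemma cop_counit:
  assumes "p \<in> carrier G" "x \<in> A p"
  shows "tensor_lift (\<lambda>x y. \<epsilon> x *\<^sub>C y) (cop \<one> p x) = x"
proof -
  have "tensor_lift (\<lambda>x y. \<epsilon> x *\<^sub>C y) (the_elem_of (T1 \<Delta> x (unit p))) = x * unit p"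
    using counit by (simp add: is_counit_def)
  then show ?thesis using incl_cop(3) [of \<one> p x] assms by (simp add: unit)
qed

lemma counit_nontrivial: "\<exists>x\<in>A \<one>. \<epsilon> x \<noteq> 0"
proof (rule ccontr)
  assume "\<not> ?thesis"
  then have 0: "\<epsilon> x = 0" if "x \<in> A \<one>" for x using that by blast
  have "tensor_lift (\<lambda>x y. \<epsilon> x *\<^sub>C y) (cop \<one> \<one> (unit \<one>)) = 0"
    by (rule linear_eq_on_tensor_subspace [OF clinear_tensor_lift _ _ cop_in])
      (simp_all add: clinear_iff cbilinear_counit 0)
  then show False using unit_nonzero [of \<one>] cop_counit [of \<one> "unit \<one>"] by (simp add: unit)
qed

lemma clinear_S: "clinear S" and S_antimult: "S (x * y) = S y * S x"
  using antipode by (simp_all add: is_antipode_def algebra_antihom_def)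

lemma cbilinear_S: "cbilinear (\<lambda>x y. S x * incl y)"
  by (rule cbilinearI) (simp_all add: clinearD [OF clinear_S] clinearD [OF clinear_incl]
      distrib_left distrib_right mult_scaleC_left mult_scaleC_right)

text \<open>
  The antipode axiom sends \<open>\<Delta>(a)(1 \<otimes> b)\<close>, with \<open>a\<close> in \<open>A\<^sub>p\<^sub>r\<close> and \<open>b\<close> in \<open>A\<^sub>r\<close>, to \<open>\<epsilon>(a) b\<close>; by
  \<open>counit_other\<close> this vanishes unless \<open>p r = e\<close>.
\<close>

lemma S_mult_in:
  assumes "p \<in> carrier G" "r \<in> carrier G" and x: "x \<in> A p" and y: "y \<in> A r"
  shows "S x * incl y \<in> (if p \<otimes> r = \<one> then incl ` A r else {0})" (is "_ \<in> ?V")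
proof -
  have "cvec.subspace (incl ` A r)"
    using subspace_A [OF assms(2)]
    by (auto simp: cvec.subspace_def clinearD [OF clinear_incl, symmetric] image_iff)
  then have V: "cvec.subspace ?V" by simp
  have "tensor_lift (\<lambda>x y. S x * incl y) (x \<otimes>\<^sub>C y) \<in> ?V"
  proof (rule T1_induct [OF assms(1,2) _ clinear_tensor_lift V])
    show "x \<otimes>\<^sub>C y \<in> tensor_subspace (A p) (A r)"
      by (intro tens_in_tensor_subspace x y)
    show "tensor_lift (\<lambda>x y. S x * incl y) (the_elem_of (T1 \<Delta> a b)) \<in> ?V"
      if "a \<in> A (p \<otimes> r)" "b \<in> A r" for a b
    proof -
      have "tensor_lift (\<lambda>x y. S x * incl y) (the_elem_of (T1 \<Delta> a b)) = incl (\<epsilon> a *\<^sub>C b)"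
        using antipode by (simp add: is_antipode_def)
      moreover have "\<epsilon> a *\<^sub>C b \<in> A r"
        using cvec.subspace_scale [OF subspace_A] assms that by blast
      ultimately show ?thesis
        using counit_other [of "p \<otimes> r" a] assms that by (simp add: clinearD(3) [OF clinear_incl])
    qed
  qed
  then show ?thesis by (simp add: cbilinear_S)
qed

text \<open>
  The multiplier \<open>S(x)\<close> acts as \<open>0\<close> on every component but \<open>A\<^sub>q\<close>, with \<open>q = p\<^sup>-\<^sup>1\<close>, and there it acts as
  the element \<open>S(x) 1\<^sub>q\<close> of \<open>A\<^sub>q\<close>. Non-degeneracy gives the same for the action from the right.
\<close>

lemma S_in:
  assumes p: "p \<in> carrier G" and x: "x \<in> A p"
  shows "S x \<in> incl ` A (inv p)"
proof -
  let ?u = "unit (inv p)"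
  have ip: "inv p \<in> carrier G" "p \<otimes> inv p = \<one>" using p by simp_all
  obtain s where s: "s \<in> A (inv p)" "S x * incl ?u = incl s"
    using S_mult_in [OF p ip(1) x unit(1) [OF ip(1)]] ip by auto
  then have su: "lmul (S x) ?u = s" by (simp add: mult_incl inj_eq [OF inj_incl_A])
  have L: "lmul (S x) y = s * y" for y
  proof (induction y rule: component_induct)
    case (comp r y)
    show ?case
    proof (cases "r = inv p")
      case True
      have "lmul (S x) y = lmul (S x) (?u * y)" using comp True by (simp add: unit)
      then show ?thesis by (simp add: multiplier_laws su)
    next
      case False
      then have "p \<otimes> r \<noteq> \<one>" using p comp by (metis inv_equality inv_inv inv_closed)
      then have "incl (lmul (S x) y) = incl 0"
        using S_mult_in [OF p comp(1) x comp(2)]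
        by (simp add: mult_incl clinearD [OF clinear_incl])
      then show ?thesis
        using mult_A_0 [OF ip(1) comp(1) _ s(1) comp(2)] False by (auto simp: inj_eq [OF inj_incl_A])
    qed
  qed (simp_all add: clinearD [OF multiplier_laws(1)] distrib_left)
  have "rmul (S x) z = z * s" for z
  proof -
    have "(rmul (S x) z - z * s) * y = 0" for y
      by (simp add: left_diff_distrib L mult.assoc flip: multiplier_laws(5))
    moreover have "nondegenerate (UNIV :: 'a set)"
      using mha by (simp add: multiplier_hopf_algebra_def)
    ultimately have "rmul (S x) z - z * s = 0" unfolding nondegenerate_def by blast
    then show ?thesis by simp
  qed
  then have "S x = incl s" by (intro multiplier_eqI) (simp_all add: L lmul_incl rmul_incl fun_eq_iff)
  then show ?thesis using s by simp
qed

abbreviation T :: "'a \<Rightarrow> 'a"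
  where "T \<equiv> antipode_in S"

lemma incl_T: "incl (T x) = S x"
proof -
  have "S x \<in> range incl"
  proof (induction x rule: component_induct)
    case (add x y)
    then show ?case
      by (auto simp: clinearD [OF clinear_S] clinearD [OF clinear_incl, symmetric])
  next
    case (comp p x)
    then show ?case using S_in by blast
  qed (auto simp: clinearD [OF clinear_S] clinearD [OF clinear_incl] image_iff intro: exI [of _ 0])
  then show ?thesis by (auto simp: antipode_in_def the_elem_of_incl)
qed

lemma T_in: "\<lbrakk>p \<in> carrier G; x \<in> A p\<rbrakk> \<Longrightarrow> T x \<in> A (inv p)"
  using S_in [of p x] by (auto simp: antipode_in_def the_elem_of_incl)

lemma clinear_T: "clinear T"
  by (rule clinearI; rule injD [OF inj_incl_A])
    (simp_all add: incl_T clinearD [OF clinear_S] clinearD [OF clinear_incl])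

lemma T_antimult: "T (x * y) = T y * T x"
  by (rule injD [OF inj_incl_A]) (simp add: incl_T incl_mult S_antimult)

lemma cbilinear_T: "cbilinear (\<lambda>x y. T x * y)"
  by (rule cbilinearI) (simp_all add: clinearD [OF clinear_T]
      distrib_left distrib_right mult_scaleC_left mult_scaleC_right)

lemma incl_T_lift: "tensor_lift (\<lambda>x y. S x * incl y) t = incl (tensor_lift (\<lambda>x y. T x * y) t)"
  by (induction t) (simp_all add: cbilinear_S cbilinear_T incl_mult incl_T
      clinearD [OF clinear_incl] clinearD [OF clinear_tensor_lift])

lemma cop_antipode:
  assumes "p \<in> carrier G" "x \<in> A \<one>"
  shows "tensor_lift (\<lambda>x y. T x * y) (cop p (inv p) x) = \<epsilon> x *\<^sub>C unit (inv p)"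
proof (rule injD [OF inj_incl_A])
  have "tensor_lift (\<lambda>x y. S x * incl y) (the_elem_of (T1 \<Delta> x (unit (inv p)))) =
      incl (\<epsilon> x *\<^sub>C unit (inv p))"
    using antipode by (simp add: is_antipode_def)
  then show "incl (tensor_lift (\<lambda>x y. T x * y) (cop p (inv p) x)) = incl (\<epsilon> x *\<^sub>C unit (inv p))"
    using incl_cop(3) [of p "inv p" x] assms by (simp add: incl_T_lift)
qed

text \<open>
  Since \<open>S(1\<^sub>p) S(x) = S(x)\<close>, the element \<open>S(1\<^sub>p)\<close> is a left identity for the products \<open>S(x) y\<close>, with
  \<open>x\<close> in \<open>A\<^sub>p\<close>. By the antipode law a sum of these is a non-zero multiple of the identity of \<open>A\<^sub>q\<close>.
\<close>

lemma T_unit: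
  assumes p: "p \<in> carrier G"
  shows "T (unit p) = unit (inv p)"
proof -
  obtain x where x: "x \<in> A \<one>" "\<epsilon> x \<noteq> 0" using counit_nontrivial by blast
  let ?m = "tensor_lift (\<lambda>x y. T x * y)"
  have "T (unit p) * ?m (cop p (inv p) x) = ?m (cop p (inv p) x)"
  proof (rule linear_eq_on_tensor_subspace [OF _ _ _ cop_in])
    show "T (unit p) * ?m (a \<otimes>\<^sub>C b) = ?m (a \<otimes>\<^sub>C b)" if "a \<in> A p" for a b
      using that p by (simp add: cbilinear_T unit flip: mult.assoc T_antimult)
  qed (simp_all add: p clinear_iff clinearD [OF clinear_tensor_lift] distrib_left mult_scaleC_right)
  then have "T (unit p) * unit (inv p) = unit (inv p)"
    using x p by (simp add: cop_antipode mult_scaleC_right)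
  then show ?thesis using T_in [OF p unit(1) [OF p]] p by (simp add: unit)
qed

section \<open>The trace identity\<close>

lemma clinear_component_dual: "g \<in> component_dual G A p \<Longrightarrow> clinear g"
  by (simp add: component_dual_def)

lemma dual_mult_in:
  assumes "p \<in> carrier G" "q \<in> carrier G"
  shows "dual_mult G A \<Delta> p q f g \<in> component_dual G A (p \<otimes> q)"
proof -
  have "dual_mult G A \<Delta> p q f g = (\<lambda>a. tensor_functional f g (cop p q a))"
    by (simp add: dual_mult_eq fun_eq_iff)
  then show ?thesis
    using assms by (auto simp: component_dual_def tensor_functional_def cop_other clinear_iff
        clinearD [OF clinear_tensor_lift] clinearD [OF clinear_cop])
qed

text \<open>
  Summing against the dual bases puts \<open>S(d\<^sub>1) d\<^sub>2 g(d\<^sub>3)\<close> on the left-hand side, where the coproduct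
  is applied as \<open>\<Delta>\<^sub>p\<^sub>,\<^sub>e\<close> followed by \<open>\<Delta>\<^sub>q\<^sub>,\<^sub>p\<close> on the second leg. After coassociativity \<open>\<Delta>\<^sub>p\<^sub>,\<^sub>q\<close> is
  applied to the first leg of \<open>\<Delta>\<^sub>e\<^sub>,\<^sub>p(d)\<close> instead, so that the antipode and counit laws apply.
\<close>

lemma antipode_contraction:
  assumes p: "p \<in> carrier G" and d: "d \<in> A p"
    and finite: "finite J" "finite K"
    and e: "is_basis J e (A p)" and f: "\<And>j. j \<in> J \<Longrightarrow> clinear (f j)"
      "\<And>i j. \<lbrakk>i \<in> J; j \<in> J\<rbrakk> \<Longrightarrow> f i (e j) = (if i = j then 1 else 0)"
    and e': "is_basis K e' (A (inv p))" and f': "\<And>k. k \<in> K \<Longrightarrow> clinear (f' k)"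
      "\<And>i j. \<lbrakk>i \<in> K; j \<in> K\<rbrakk> \<Longrightarrow> f' i (e' j) = (if i = j then 1 else 0)"
    and g: "clinear g"
  shows "(\<Sum>k\<in>K. \<Sum>j\<in>J. dual_mult G A \<Delta> p \<one> (f j) (dual_mult G A \<Delta> (inv p) p (f' k) g) d
      *\<^sub>C (T (e j) * e' k)) = g d *\<^sub>C unit (inv p)"
proof -
  let ?q = "inv p"
  define h where "h k = dual_mult G A \<Delta> ?q p (f' k) g" for k
  have q: "?q \<in> carrier G" using p by simp
  have h: "clinear (h k)" for k
    unfolding h_def using clinear_component_dual [OF dual_mult_in [OF q p]] .
  have Te: "(\<Sum>j\<in>J. f j x *\<^sub>C (T (e j) * y)) = T x * y" if "x \<in> A p" for x y
  proof -
    have "T x = (\<Sum>j\<in>J. f j x *\<^sub>C T (e j))"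
      using arg_cong [OF basis_expansion [OF e finite(1) f that], of T]
      by (simp add: clinear_sum [OF clinear_T] clinearD [OF clinear_T])
    then show ?thesis by (simp add: sum_distrib_right mult_scaleC_left)
  qed
  have Te': "(\<Sum>k\<in>K. f' k y *\<^sub>C (x * e' k)) = x * y" if "y \<in> A ?q" for x y
  proof -
    have "x * y = x * (\<Sum>k\<in>K. f' k y *\<^sub>C e' k)"
      using basis_expansion [OF e' finite(2) f' that] by simp
    then show ?thesis by (simp add: sum_distrib_left mult_scaleC_right)
  qed
  have bg: "cbilinear (\<lambda>y z. g z *\<^sub>C (T x * y))" for x
    by (rule cbilinearI) (simp_all add: clinearD [OF g] distrib_left mult_scaleC_right
        scaleC_add_left scaleC_add_right scaleC_scaleC scaleC_complex_def mult.commute)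
  have bt: "cbilinear (\<lambda>x s. tensor_lift (\<lambda>y z. g z *\<^sub>C (T x * y)) s)"
  proof (rule cbilinearI)
    fix x x' s c
    show "tensor_lift (\<lambda>y z. g z *\<^sub>C (T (x + x') * y)) s =
        tensor_lift (\<lambda>y z. g z *\<^sub>C (T x * y)) s + tensor_lift (\<lambda>y z. g z *\<^sub>C (T x' * y)) s"
      by (induction s) (simp_all only: tensor_lift_tens [OF bg],
          simp_all add: clinearD [OF clinear_tensor_lift] clinearD [OF clinear_T] distrib_right
          scaleC_add_right)
    show "tensor_lift (\<lambda>y z. g z *\<^sub>C (T (c *\<^sub>C x) * y)) s =
        c *\<^sub>C tensor_lift (\<lambda>y z. g z *\<^sub>C (T x * y)) s"
      by (induction s) (simp_all only: tensor_lift_tens [OF bg],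
          simp_all add: clinearD [OF clinear_tensor_lift] clinearD [OF clinear_T]
          mult_scaleC_left scaleC_scaleC mult.commute scaleC_add_right)
  qed (simp_all add: clinearD [OF clinear_tensor_lift])
  \<comment> \<open>\<open>\<Psi>\<close> is the map \<open>x \<otimes> y \<otimes> z \<mapsto> g(z) S(x) y\<close>.\<close>
  define \<Psi> where "\<Psi> = tensor_lift (\<lambda>x s. tensor_lift (\<lambda>y z. g z *\<^sub>C (T x * y)) s)"
  have \<Psi>: "clinear \<Psi>" and \<Psi>_tens: "\<Psi> (x \<otimes>\<^sub>C s) = tensor_lift (\<lambda>y z. g z *\<^sub>C (T x * y)) s" for x s
    by (simp_all add: \<Psi>_def clinear_tensor_lift bt)
  have id: "clinear (\<lambda>y. y)" by (simp add: clinear_iff)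
  have hs: "(\<Sum>k\<in>K. h k y *\<^sub>C (T x * e' k)) = \<Psi> (x \<otimes>\<^sub>C cop ?q p y)" for x y
    unfolding h_def dual_mult_eq \<Psi>_tens
  proof (rule linear_eq_on_tensor_subspace [OF _ _ _ cop_in [OF q p]])
    show "(\<Sum>k\<in>K. tensor_functional (f' k) g (a \<otimes>\<^sub>C b) *\<^sub>C (T x * e' k)) =
        tensor_lift (\<lambda>y z. g z *\<^sub>C (T x * y)) (a \<otimes>\<^sub>C b)" if "a \<in> A ?q" "b \<in> A p" for a b
    proof -
      have "(\<Sum>k\<in>K. tensor_functional (f' k) g (a \<otimes>\<^sub>C b) *\<^sub>C (T x * e' k)) =
          g b *\<^sub>C (\<Sum>k\<in>K. f' k a *\<^sub>C (T x * e' k))"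
        by (simp add: cvec.scale_sum_right tensor_functional_tens [OF f'(1) g] scaleC_scaleC
            mult.commute cong: sum.cong)
      then show ?thesis by (simp add: Te' that tensor_lift_tens [OF bg])
    qed
  qed (simp_all add: clinear_iff tensor_functional_def clinearD [OF clinear_tensor_lift]
      scaleC_add_left sum.distrib cvec.scale_sum_right scaleC_scaleC scaleC_complex_def)
  have "(\<Sum>k\<in>K. \<Sum>j\<in>J. tensor_functional (f j) (h k) (cop p \<one> d) *\<^sub>C (T (e j) * e' k)) =
      \<Psi> (tensor_map (\<lambda>y. y) (cop ?q p) (cop p \<one> d))"
  proof (rule linear_eq_on_tensor_subspace [OF _ _ _ cop_in [OF p one_closed]])
    fix x y assume x: "x \<in> A p" and y: "y \<in> A \<one>"
    have "(\<Sum>k\<in>K. \<Sum>j\<in>J. tensor_functional (f j) (h k) (x \<otimes>\<^sub>C y) *\<^sub>C (T (e j) * e' k)) =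
        (\<Sum>k\<in>K. h k y *\<^sub>C (\<Sum>j\<in>J. f j x *\<^sub>C (T (e j) * e' k)))"
      by (simp add: cvec.scale_sum_right tensor_functional_tens [OF f(1) h] scaleC_scaleC
          mult.commute cong: sum.cong)
    also have "\<dots> = \<Psi> (x \<otimes>\<^sub>C cop ?q p y)" by (simp add: Te [OF x] hs)
    finally show "(\<Sum>k\<in>K. \<Sum>j\<in>J. tensor_functional (f j) (h k) (x \<otimes>\<^sub>C y) *\<^sub>C (T (e j) * e' k)) =
        \<Psi> (tensor_map (\<lambda>y. y) (cop ?q p) (x \<otimes>\<^sub>C y))"
      by (simp add: tensor_map_tens id clinear_cop p q)
  qed (simp_all add: clinear_iff tensor_functional_def clinearD [OF clinear_tensor_lift]
      clinearD [OF clinear_tensor_map] clinearD [OF \<Psi>]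
      scaleC_add_left sum.distrib cvec.scale_sum_right scaleC_scaleC scaleC_complex_def)
  also have "\<dots> = \<Psi> (tensor_assoc (tensor_map (cop p ?q) (\<lambda>y. y) (cop \<one> p d)))"
    using cop_coassoc [OF p q p, of d] p d by simp
  also have "\<dots> = g (tensor_lift (\<lambda>x y. \<epsilon> x *\<^sub>C y) (cop \<one> p d)) *\<^sub>C unit ?q"
  proof (rule linear_eq_on_tensor_subspace [OF _ _ _ cop_in [OF one_closed p]])
    fix w z assume w: "w \<in> A \<one>" and z: "z \<in> A p"
    have "\<Psi> (tensor_assoc (s \<otimes>\<^sub>C z)) = g z *\<^sub>C tensor_lift (\<lambda>x y. T x * y) s" for s
      by (induction s) (simp_all add: \<Psi>_tens tensor_lift_tens [OF bg] cbilinear_T tens_simps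
          clinearD [OF clinear_tensor_assoc(1)] clinearD [OF \<Psi>] clinearD [OF clinear_tensor_lift]
          scaleC_add_right)
    then show "\<Psi> (tensor_assoc (tensor_map (cop p ?q) (\<lambda>y. y) (w \<otimes>\<^sub>C z))) =
        g (tensor_lift (\<lambda>x y. \<epsilon> x *\<^sub>C y) (w \<otimes>\<^sub>C z)) *\<^sub>C unit ?q"
      by (simp add: tensor_map_tens id clinear_cop p q cop_antipode w cbilinear_counit
          clinearD [OF g] scaleC_scaleC scaleC_complex_def mult.commute)
  qed (simp_all add: clinear_iff clinearD [OF clinear_tensor_lift] clinearD [OF g]
      clinearD [OF clinear_tensor_map] clinearD [OF \<Psi>] clinearD [OF clinear_tensor_assoc(1)]
      scaleC_add_left scaleC_scaleC scaleC_complex_def)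
  also have "\<dots> = g d *\<^sub>C unit ?q" by (simp add: cop_counit p d)
  finally show ?thesis by (simp add: dual_mult_eq h_def)
qed

end

theorem proposition3p10:
  fixes G :: "('g, 'm) monoid_scheme"
    and \<Delta> :: "'a::complex_algebra coproduct"
    and A :: "'g \<Rightarrow> 'a set"
    and \<epsilon> :: "'a \<Rightarrow> complex"
    and S :: "'a \<Rightarrow> 'a multiplier"
    and I :: "'g \<Rightarrow> 'i set"
    and e :: "'g \<Rightarrow> 'i \<Rightarrow> 'a"
    and f :: "'g \<Rightarrow> 'i \<Rightarrow> 'a \<Rightarrow> complex"
  assumes "group G"
    and "regular_multiplier_hopf_algebra \<Delta>"
    and "cograded G A \<Delta>"
    and "\<And>p. p \<in> carrier G \<Longrightarrow> finite_dimensional (A p) \<and> has_identity (A p)"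
    and "is_counit \<Delta> \<epsilon>"
    and "is_antipode \<Delta> \<epsilon> S"
    and "\<And>p. p \<in> carrier G \<Longrightarrow> is_basis (I p) (e p) (A p)"
    and "\<And>p i. \<lbrakk>p \<in> carrier G; i \<in> I p\<rbrakk> \<Longrightarrow> f p i \<in> component_dual G A p"
    and "\<And>p i j. \<lbrakk>p \<in> carrier G; i \<in> I p; j \<in> I p\<rbrakk> \<Longrightarrow> f p i (e p j) = (if i = j then 1 else 0)"
  shows "(\<forall>p\<in>carrier G. \<forall>g\<in>component_dual G A p. \<forall>a\<in>A p.
            g a = (\<Sum>i\<in>I (inv\<^bsub>G\<^esub> p).
              phi G A \<Delta> S I e f (dual_mult G A \<Delta> (inv\<^bsub>G\<^esub> p) p (f (inv\<^bsub>G\<^esub> p) i) g)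
                (a * antipode_in S (e (inv\<^bsub>G\<^esub> p) i))))
       \<and> (\<exists>h\<in>component_dual G A \<one>\<^bsub>G\<^esub>. phi G A \<Delta> S I e f h \<noteq> (\<lambda>_. 0))"
proof -
  interpret unital_cograded G \<Delta> A \<epsilon> S
    using assms(1-6) by (intro unital_cograded.intro unital_cograded_axioms.intro)
      (auto simp: regular_multiplier_hopf_algebra_def)
  note basis = assms(7) and dual = assms(8) and biorth = assms(9)
  have lin: "clinear (f p i)" if "p \<in> carrier G" "i \<in> I p" for p i
    using dual [OF that] by (rule clinear_component_dual)
  have fin: "finite (I p)" if p: "p \<in> carrier G" for p
  proof -
    obtain B where "finite B" "cvec.span B = A p"
      using assms(4) [OF p] by (auto simp: finite_dimensional_def)
    then have "finite (e p ` I p)"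
      using cvec.independent_span_bound [of B "e p ` I p"] basis [OF p]
        cvec.span_superset [of "e p ` I p"]
      by (simp add: is_basis_def)
    then show ?thesis using basis [OF p] finite_imageD by (auto simp: is_basis_def)
  qed
  have e_in: "e p i \<in> A p" if "p \<in> carrier G" "i \<in> I p" for p i
    using basis [OF that(1)] that(2) cvec.span_base [of "e p i" "e p ` I p"] by (auto simp: is_basis_def)
  have main: "g a = (\<Sum>i\<in>I (inv\<^bsub>G\<^esub> p).
      phi G A \<Delta> S I e f (dual_mult G A \<Delta> (inv\<^bsub>G\<^esub> p) p (f (inv\<^bsub>G\<^esub> p) i) g)
        (a * antipode_in S (e (inv\<^bsub>G\<^esub> p) i)))"
    if p: "p \<in> carrier G" and g: "g \<in> component_dual G A p" and a: "a \<in> A p" for p g a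
  proof -
    let ?q = "inv\<^bsub>G\<^esub> p"
    define h where "h i = dual_mult G A \<Delta> ?q p (f ?q i) g" for i
    define K where "K i j = dual_mult G A \<Delta> p \<one>\<^bsub>G\<^esub> (f p j) (h i)" for i j
    have q: "?q \<in> carrier G" using p by simp
    have K: "clinear (K i j)" for i j
      unfolding K_def using clinear_component_dual [OF dual_mult_in [OF p one_closed]] .
    have glin: "clinear g" using g by (rule clinear_component_dual)
    have aT: "a * T x \<in> A p" if "x \<in> A ?q" for x
      using T_in [OF q that] p by (simp add: A_left_ideal)
    \<comment> \<open>Only the summand for \<open>r = p\<close> survives, since \<open>S\<^sup>2\<close> preserves each component.\<close>
    have phi: "phi G A \<Delta> S I e f h' b =
        (\<Sum>j\<in>I p. dual_mult G A \<Delta> p \<one>\<^bsub>G\<^esub> (f p j) h' (b * T (T (e p j))))"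
      if b: "b \<in> A p" for h' b
    proof -
      have "dual_mult G A \<Delta> r \<one>\<^bsub>G\<^esub> (f r j) h' (b * T (T (e r j))) = 0"
        if "r \<in> carrier G" "r \<noteq> p" "j \<in> I r" for r j
      proof -
        have "T (T (e r j)) \<in> A r" using T_in [OF _ T_in [OF that(1) e_in]] that by simp
        then have "b * T (T (e r j)) = 0" using mult_A_0 [OF p that(1)] that(2) b by metis
        then show ?thesis
          using clinearD(3) [OF clinear_component_dual [OF dual_mult_in [OF that(1) one_closed]]]
          by simp
      qed
      then have "phi G A \<Delta> S I e f h' b = sum' (\<lambda>r. \<Sum>j\<in>I r.
          dual_mult G A \<Delta> r \<one>\<^bsub>G\<^esub> (f r j) h' (b * T (T (e r j)))) {p}"
        unfolding phi_def using p by (intro sum.mono_neutral_right') auto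
      then show ?thesis by (simp add: sum.eq_sum)
    qed
    have "(\<Sum>i\<in>I ?q. phi G A \<Delta> S I e f (h i) (a * T (e ?q i))) =
        (\<Sum>i\<in>I ?q. \<Sum>j\<in>I p. K i j (a * T (T (e p j) * e ?q i)))"
      by (rule sum.cong) (simp_all add: phi aT e_in q K_def T_antimult mult.assoc)
    \<comment> \<open>Expand \<open>S(e\<^sub>j) e\<^sub>i\<close> in the basis of \<open>A\<^sub>q\<close>; the coefficients later recombine inside \<open>f\<^sub>k\<close>.\<close>
    also have "\<dots> = (\<Sum>i\<in>I ?q. \<Sum>j\<in>I p. \<Sum>k\<in>I ?q.
        f ?q k (T (e p j) * e ?q i) * K i j (a * T (e ?q k)))"
    proof (intro sum.cong refl)
      fix i j assume i: "i \<in> I ?q" and j: "j \<in> I p"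
      let ?c = "T (e p j) * e ?q i"
      have "?c \<in> A ?q" using A_left_ideal [OF q e_in [OF q i]] .
      from basis_expansion [OF basis [OF q] fin [OF q] lin [OF q] biorth [OF q] this]
      have "K i j (a * T ?c) = K i j (a * T (\<Sum>k\<in>I ?q. f ?q k ?c *\<^sub>C e ?q k))" by simp
      then show "K i j (a * T ?c) = (\<Sum>k\<in>I ?q. f ?q k ?c * K i j (a * T (e ?q k)))"
        by (simp add: clinear_sum [OF clinear_T] clinearD [OF clinear_T] sum_distrib_left
            mult_scaleC_right clinear_sum [OF K] clinearD [OF K] scaleC_complex_def)
    qed
    also have "\<dots> = (\<Sum>i\<in>I ?q. \<Sum>k\<in>I ?q. \<Sum>j\<in>I p.
        f ?q k (T (e p j) * e ?q i) * K i j (a * T (e ?q k)))"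
      by (rule sum.cong [OF refl sum.swap])
    also have "\<dots> = (\<Sum>k\<in>I ?q. \<Sum>i\<in>I ?q. \<Sum>j\<in>I p.
        f ?q k (T (e p j) * e ?q i) * K i j (a * T (e ?q k)))"
      by (rule sum.swap)
    also have "\<dots> = (\<Sum>k\<in>I ?q. f ?q k (\<Sum>i\<in>I ?q. \<Sum>j\<in>I p.
        K i j (a * T (e ?q k)) *\<^sub>C (T (e p j) * e ?q i)))"
      by (rule sum.cong) (simp_all add: clinear_sum [OF lin [OF q]] clinearD [OF lin [OF q]]
          scaleC_complex_def mult.commute)
    also have "\<dots> = (\<Sum>k\<in>I ?q. f ?q k (g (a * T (e ?q k)) *\<^sub>C unit ?q))"
    proof (intro sum.cong refl arg_cong [of _ _ "f ?q _"])
      fix k assume k: "k \<in> I ?q"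
      show "(\<Sum>i\<in>I ?q. \<Sum>j\<in>I p. K i j (a * T (e ?q k)) *\<^sub>C (T (e p j) * e ?q i)) =
          g (a * T (e ?q k)) *\<^sub>C unit ?q"
        unfolding K_def h_def
        by (rule antipode_contraction [OF p aT [OF e_in [OF q k]] fin [OF p] fin [OF q]
              basis [OF p] lin [OF p] biorth [OF p] basis [OF q] lin [OF q] biorth [OF q] glin])
    qed
    also have "\<dots> = g (a * T (\<Sum>k\<in>I ?q. f ?q k (unit ?q) *\<^sub>C e ?q k))"
      by (simp add: clinearD [OF lin [OF q]] clinear_sum [OF clinear_T] clinearD [OF clinear_T]
          sum_distrib_left mult_scaleC_right clinear_sum [OF glin] clinearD [OF glin]
          scaleC_complex_def mult.commute)
    also have "(\<Sum>k\<in>I ?q. f ?q k (unit ?q) *\<^sub>C e ?q k) = unit ?q"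
      using basis_expansion [OF basis [OF q] fin [OF q] lin [OF q] biorth [OF q] unit(1) [OF q]]
      by simp
    also have "g (a * T (unit ?q)) = g a" using p a by (simp add: T_unit q unit)
    finally show ?thesis by (simp add: h_def)
  qed
  moreover have "\<exists>h\<in>component_dual G A \<one>\<^bsub>G\<^esub>. phi G A \<Delta> S I e f h \<noteq> (\<lambda>_. 0)"
  proof (rule ccontr)
    assume "\<not> ?thesis"
    then have 0: "phi G A \<Delta> S I e f h = (\<lambda>_. 0)" if "h \<in> component_dual G A \<one>\<^bsub>G\<^esub>" for h
      using that by blast
    have "I \<one>\<^bsub>G\<^esub> \<noteq> {}"
      using basis [OF one_closed] A_nontrivial [OF one_closed] by (auto simp: is_basis_def)
    then obtain i where i: "i \<in> I \<one>\<^bsub>G\<^esub>" by blast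
    have "f \<one>\<^bsub>G\<^esub> i (e \<one>\<^bsub>G\<^esub> i) = 0"
      using main [OF one_closed dual [OF one_closed i] e_in [OF one_closed i]]
        0 dual_mult_in [OF one_closed one_closed] by simp
    then show False using biorth [OF one_closed i i] by simp
  qed
  ultimately show ?thesis by blast
qed

end
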